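(* For every constant $k\ge 2$ there is a polynomial-time algorithm $A$ such that the following holds. Let $f\colon\{0,1\}^n\to\{0,1\}$ with $f\in R_k$, and let $\pi$ be a $k$-party dag-like protocol with inputs from $f^{-1}(0)\times\dots\times f^{-1}(0)$ and outputs in $[n]\times\{0,1\}$ which strongly computes the $R_k$-communication game for $f$. Then, given the light form of $\pi$, $A$ outputs a circuit $C\le f$ consisting only of $\mathrm{THR}^{k+1}_2$ gates and literals, with $\mathrm{depth}(C)=O(\mathrm{depth}(\pi))$ and $\mathrm{size}(C)=O(\mathrm{size}(\pi)^{O(1)})$.
   Context: $R_k$ is the set of $f\colon\{0,1\}^n\to\{0,1\}$ such that any $x^1,\dots,x^k\in f^{-1}(0)$ have a coordinate $i$ with $x^1_i=\dots=x^k_i$. A $k$-party dag-like protocol with inputs from $\mathcal X_1\times\dots\times\mathcal X_k$ and outputs from $\mathcal Y$ is a tuple $\pi=\langle G,P_1,\dots,P_k,\phi_1,\dots,\phi_k,l\rangle$ where: $G$ is a finite directed acyclic multigraph with a starting node $s$ from which every node is reachable, every non-terminal node having exactly two outgoing edges labeled $0$ and $1$; $P_1,\dots,P_k$ partition the non-terminal nodes; $\phi_i\colon P_i\times\mathcal X_i\to\{0,1\}$; $l$ maps terminal nodes to $\mathcal Y$. $\mathrm{depth}(\pi)$ is the maximal length of a path from $s$; $\mathrm{size}(\pi)$ the number of nodes. An $x\in\mathcal X_i$ is $i$-compatible with an edge $e$ from $v$ if $v\notin P_i$ or $e$ is labeled $\phi_i(v,x)$; with a path if compatible with all its edges; with a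 node $v$ if some path from $s$ to $v$ is $i$-compatible with $x$. The light form of $\pi$ is $\langle G,P_1,\dots,P_k,l\rangle$. Here $\mathcal X_i=f^{-1}(0)$, $\mathcal Y=[n]\times\{0,1\}$, and $\pi$ strongly computes the $R_k$-communication game for $f$ if for every terminal $t$, every $x\in f^{-1}(0)$ and every $i\in[k]$: if $x$ is $i$-compatible with $t$ then $x_j=b$ where $(j,b)=l(t)$. A circuit consisting only of $\mathrm{THR}^{k+1}_2$ gates (output $1$ iff at least two of the $k+1$ inputs are $1$) and literals is a DAG with an output node, internal nodes $\mathrm{THR}^{k+1}_2$ gates with $k+1$ ordered inputs, input nodes labeled by $x_i$ or $\neg x_i$ (no constants); depth is the longest output-to-input path length (negations not counted), size the number of nodes. $C\le f$ means $C(x)=0$ for all $x\in f^{-1}(0)$. *)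

theory Defs
  imports Main
begin

section \<open>Boolean functions and the class R\<close>

text \<open>
  A point of the cube is a list of length \<open>n\<close>, coordinates are numbered \<open>0, \<dots>, n - 1\<close>,
  and parties \<open>0, \<dots>, k - 1\<close>.  A Boolean function of \<open>n\<close> arguments is a HOL function on lists
  of which only the values on lists of length \<open>n\<close> are ever used.
\<close>

definition zeros :: "nat \<Rightarrow> (bool list \<Rightarrow> bool) \<Rightarrow> bool list set" where
  "zeros n f = {x. length x = n \<and> \<not> f x}"

definition R :: "nat \<Rightarrow> nat \<Rightarrow> (bool list \<Rightarrow> bool) set" where
  "R k n = {f. \<forall>X. (\<forall>i<k. X i \<in> zeros n f) \<longrightarrow>
                 (\<exists>j<n. \<forall>i<k. \<forall>i'<k. X i ! j = X i' ! j)}"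


section \<open>Dag-like protocols\<close>

text \<open>
  The nodes are \<open>0, \<dots>, num_nodes - 1\<close>.  A node in \<open>inner\<close> has exactly the two outgoing edges
  \<open>(v, False)\<close> and \<open>(v, True)\<close>, leading to \<open>child v False\<close> and \<open>child v True\<close>, which may
  coincide (multigraph); the other nodes are terminal and have no outgoing edge.  Party \<open>i\<close> owns
  the nodes in \<open>part i\<close>.  The values of \<open>child\<close>, \<open>part\<close>, \<open>leaf\<close> and \<open>speak\<close> outside their
  intended domains are irrelevant.
\<close>

record light_form =
  num_nodes :: nat
  start :: nat
  inner :: "nat set"
  child :: "nat \<Rightarrow> bool \<Rightarrow> nat"
  part :: "nat \<Rightarrow> nat set"
  leaf :: "nat \<Rightarrow> nat \<times> bool"

text \<open>\<open>speak \<pi> i v x\<close> is the bit that party \<open>i\<close> holding \<open>x\<close> sends at its node \<open>v\<close>.\<close>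

record protocol = light_form +
  speak :: "nat \<Rightarrow> nat \<Rightarrow> bool list \<Rightarrow> bool"

abbreviation light :: "protocol \<Rightarrow> light_form" where
  "light \<equiv> light_form.truncate"

definition terminals :: "'a light_form_scheme \<Rightarrow> nat set" where
  "terminals L = {..<num_nodes L} - inner L"

text \<open>\<open>path L u es v\<close>: the edges \<open>es\<close>, in this order, form a path from \<open>u\<close> to \<open>v\<close>.\<close>

fun path :: "'a light_form_scheme \<Rightarrow> nat \<Rightarrow> (nat \<times> bool) list \<Rightarrow> nat \<Rightarrow> bool" where
  "path L u [] v \<longleftrightarrow> u = v"
| "path L u ((w, b) # es) v \<longleftrightarrow> w = u \<and> u \<in> inner L \<and> path L (child L u b) es v"

definition dag_protocol :: "nat \<Rightarrow> nat \<Rightarrow> 'a light_form_scheme \<Rightarrow> bool" where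
  "dag_protocol k n L \<longleftrightarrow>
     start L < num_nodes L \<and>
     inner L \<subseteq> {..<num_nodes L} \<and>
     (\<forall>v\<in>inner L. \<forall>b. child L v b < num_nodes L) \<and>
     acyclic {(v, child L v b) | v b. v \<in> inner L} \<and>
     (\<forall>v<num_nodes L. \<exists>es. path L (start L) es v) \<and>
     (\<Union>i<k. part L i) = inner L \<and>
     (\<forall>i<k. \<forall>j<k. i \<noteq> j \<longrightarrow> part L i \<inter> part L j = {}) \<and>
     (\<forall>t\<in>terminals L. fst (leaf L t) < n)"

definition protocol_size :: "'a light_form_scheme \<Rightarrow> nat" where
  "protocol_size L = num_nodes L"

definition protocol_depth :: "'a light_form_scheme \<Rightarrow> nat" where
  "protocol_depth L = Max {length es | es v. path L (start L) es v}"

definition edge_compatible :: "protocol \<Rightarrow> nat \<Rightarrow> bool list \<Rightarrow> nat \<times> bool \<Rightarrow> bool" where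
  "edge_compatible \<pi> i x e \<longleftrightarrow> fst e \<notin> part \<pi> i \<or> snd e = speak \<pi> i (fst e) x"

definition path_compatible :: "protocol \<Rightarrow> nat \<Rightarrow> bool list \<Rightarrow> (nat \<times> bool) list \<Rightarrow> bool" where
  "path_compatible \<pi> i x es \<longleftrightarrow> (\<forall>e\<in>set es. edge_compatible \<pi> i x e)"

definition node_compatible :: "protocol \<Rightarrow> nat \<Rightarrow> bool list \<Rightarrow> nat \<Rightarrow> bool" where
  "node_compatible \<pi> i x v \<longleftrightarrow> (\<exists>es. path \<pi> (start \<pi>) es v \<and> path_compatible \<pi> i x es)"

definition strongly_computes :: "nat \<Rightarrow> nat \<Rightarrow> (bool list \<Rightarrow> bool) \<Rightarrow> protocol \<Rightarrow> bool" where
  "strongly_computes k n f \<pi> \<longleftrightarrow>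
     (\<forall>t\<in>terminals \<pi>. \<forall>x\<in>zeros n f. \<forall>i<k.
        node_compatible \<pi> i x t \<longrightarrow> x ! fst (leaf \<pi> t) = snd (leaf \<pi> t))"


section \<open>Threshold circuits\<close>

text \<open>
  \<open>Lit j True\<close> is the literal \<open>x\<^sub>j\<close> and \<open>Lit j False\<close> its negation; \<open>Thr us\<close> is a threshold-2 gate
  with the nodes \<open>us\<close> as its inputs, possibly with repetitions.
  The nodes of a circuit are the positions in the list \<open>gates\<close>.
\<close>

datatype gate = Lit nat bool | Thr "nat list"

record circuit =
  gates :: "gate list"
  out_node :: nat

definition wires :: "circuit \<Rightarrow> (nat \<times> nat) set" where
  "wires C = {(u, v). u < length (gates C) \<and> (\<exists>us. gates C ! u = Thr us \<and> v \<in> set us)}"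

definition input_nodes :: "circuit \<Rightarrow> nat set" where
  "input_nodes C = {u. u < length (gates C) \<and> (\<exists>j s. gates C ! u = Lit j s)}"

definition thr_circuit :: "nat \<Rightarrow> nat \<Rightarrow> circuit \<Rightarrow> bool" where
  "thr_circuit k n C \<longleftrightarrow>
     out_node C < length (gates C) \<and>
     (\<forall>g\<in>set (gates C). case g of
          Lit j s \<Rightarrow> j < n
        | Thr us \<Rightarrow> length us = k + 1 \<and> set us \<subseteq> {..<length (gates C)}) \<and>
     acyclic (wires C)"

text \<open>\<open>node_value C x u b\<close>: node \<open>u\<close> has value \<open>b\<close> on input \<open>x\<close>.\<close>

inductive node_value :: "circuit \<Rightarrow> bool list \<Rightarrow> nat \<Rightarrow> bool \<Rightarrow> bool" for C x where
  lit: "\<lbrakk>u < length (gates C); gates C ! u = Lit j s\<rbrakk> \<Longrightarrow> node_value C x u (x ! j = s)"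
| thr: "\<lbrakk>u < length (gates C); gates C ! u = Thr us; list_all2 (node_value C x) us bs\<rbrakk>
        \<Longrightarrow> node_value C x u (length (filter id bs) \<ge> 2)"

lemma node_value_unique: "node_value C x u b \<Longrightarrow> node_value C x u b' \<Longrightarrow> b = b'"
proof (induction arbitrary: b' rule: node_value.induct)
  case (lit u j s)
  from lit.prems lit.hyps show ?case by cases auto
next
  case (thr u us bs)
  from thr.prems obtain bs' where bs': "list_all2 (node_value C x) us bs'"
    and b': "b' = (length (filter id bs') \<ge> 2)"
    by cases (use thr.hyps in simp_all)
  have "bs = bs'"
    using thr.IH bs' by (induction us arbitrary: bs bs') (auto simp: list_all2_Cons1)
  then show ?case by (simp only: b')
qed

definition circuit_le :: "nat \<Rightarrow> circuit \<Rightarrow> (bool list \<Rightarrow> bool) \<Rightarrow> bool" where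
  "circuit_le n C f \<longleftrightarrow> (\<forall>x\<in>zeros n f. node_value C x (out_node C) False)"

definition circuit_size :: "circuit \<Rightarrow> nat" where
  "circuit_size C = length (gates C)"

definition circuit_depth :: "circuit \<Rightarrow> nat" where
  "circuit_depth C = Max {d. \<exists>u\<in>input_nodes C. (out_node C, u) \<in> wires C ^^ d}"


section \<open>Polynomial-time algorithms\<close>

text \<open>
  Algorithms are programs of the WHILE language of N. D. Jones (Computability and Complexity from
  a Programming Perspective), whose data are the binary trees built from one atom.  Instead of
  unit cost, evaluating an expression is charged the total size of the values of all its
  subexpressions.  Hence values cannot outgrow the running time, and Turing machines and
  these programs simulate each other with polynomial overhead.
\<close>

datatype tree = Atom | Dot tree tree

fun tsize :: "tree \<Rightarrow> nat" where
  "tsize Atom = 1"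
| "tsize (Dot a b) = tsize a + tsize b + 1"

type_synonym store = "nat \<Rightarrow> tree"

datatype expr =
    Var nat
  | Quote tree
  | ECons expr expr
  | EHd expr
  | ETl expr
  | EEq expr expr

fun hd_tree :: "tree \<Rightarrow> tree" where
  "hd_tree Atom = Atom"
| "hd_tree (Dot a b) = a"

fun tl_tree :: "tree \<Rightarrow> tree" where
  "tl_tree Atom = Atom"
| "tl_tree (Dot a b) = b"

fun enc_bool :: "bool \<Rightarrow> tree" where
  "enc_bool False = Atom"
| "enc_bool True = Dot Atom Atom"

fun eval_expr :: "expr \<Rightarrow> store \<Rightarrow> tree" where
  "eval_expr (Var x) s = s x"
| "eval_expr (Quote d) s = d"
| "eval_expr (ECons e e') s = Dot (eval_expr e s) (eval_expr e' s)"
| "eval_expr (EHd e) s = hd_tree (eval_expr e s)"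
| "eval_expr (ETl e) s = tl_tree (eval_expr e s)"
| "eval_expr (EEq e e') s = enc_bool (eval_expr e s = eval_expr e' s)"

fun expr_cost :: "expr \<Rightarrow> store \<Rightarrow> nat" where
  "expr_cost (Var x) s = tsize (s x)"
| "expr_cost (Quote d) s = tsize d"
| "expr_cost (ECons e e') s =
     expr_cost e s + expr_cost e' s + tsize (eval_expr (ECons e e') s)"
| "expr_cost (EHd e) s = expr_cost e s + tsize (eval_expr (EHd e) s)"
| "expr_cost (ETl e) s = expr_cost e s + tsize (eval_expr (ETl e) s)"
| "expr_cost (EEq e e') s =
     expr_cost e s + expr_cost e' s + tsize (eval_expr (EEq e e') s)"

datatype com =
    Skip
  | Assign nat expr
  | Seq com com
  | Cond expr com com
  | Loop expr com

text \<open>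
  \<open>exec c s t s'\<close>: started in store \<open>s\<close>, the program \<open>c\<close> halts in store \<open>s'\<close> after time \<open>t\<close>.
  Every tree other than \<open>Atom\<close> counts as true.
\<close>

inductive exec :: "com \<Rightarrow> store \<Rightarrow> nat \<Rightarrow> store \<Rightarrow> bool" where
  Skip: "exec Skip s 1 s"
| Assign: "exec (Assign x e) s (expr_cost e s) (s(x := eval_expr e s))"
| Seq: "\<lbrakk>exec c1 s t1 s1; exec c2 s1 t2 s2\<rbrakk> \<Longrightarrow> exec (Seq c1 c2) s (t1 + t2) s2"
| CondTrue: "\<lbrakk>eval_expr e s \<noteq> Atom; exec c1 s t s'\<rbrakk>
             \<Longrightarrow> exec (Cond e c1 c2) s (expr_cost e s + t) s'"
| CondFalse: "\<lbrakk>eval_expr e s = Atom; exec c2 s t s'\<rbrakk>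
             \<Longrightarrow> exec (Cond e c1 c2) s (expr_cost e s + t) s'"
| LoopTrue: "\<lbrakk>eval_expr e s \<noteq> Atom; exec c s t1 s1; exec (Loop e c) s1 t2 s2\<rbrakk>
             \<Longrightarrow> exec (Loop e c) s (expr_cost e s + t1 + t2) s2"
| LoopFalse: "eval_expr e s = Atom \<Longrightarrow> exec (Loop e c) s (expr_cost e s) s"

lemma exec_deterministic: "exec c s t s' \<Longrightarrow> exec c s u s'' \<Longrightarrow> t = u \<and> s' = s''"
proof (induction arbitrary: u s'' rule: exec.induct)
  case (Skip s)
  then show ?case by cases auto
next
  case (Assign x e s)
  then show ?case by cases auto
next
  case (Seq c1 s t1 s1 c2 t2 s2)
  from Seq.prems show ?case by cases (auto dest!: Seq.IH)
next
  case (CondTrue e s c1 t s' c2)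
  from CondTrue.prems CondTrue.hyps show ?case
    by cases (auto dest!: CondTrue.IH)
next
  case (CondFalse e s c2 t s' c1)
  from CondFalse.prems CondFalse.hyps show ?case
    by cases (auto dest!: CondFalse.IH)
next
  case (LoopTrue e s c t1 s1 t2 s2)
  from LoopTrue.prems LoopTrue.hyps show ?case
    by cases (auto dest!: LoopTrue.IH)
next
  case (LoopFalse e s c)
  from LoopFalse.prems LoopFalse.hyps show ?case by cases auto
qed

text \<open>Input and output are passed in variable \<open>0\<close>.\<close>

definition halts_with :: "com \<Rightarrow> tree \<Rightarrow> nat \<Rightarrow> tree \<Rightarrow> bool" where
  "halts_with A d t r \<longleftrightarrow> (\<exists>s. exec A ((\<lambda>_. Atom)(0 := d)) t s \<and> s 0 = r)"

definition outputs :: "com \<Rightarrow> tree \<Rightarrow> tree \<Rightarrow> bool" where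
  "outputs A d r \<longleftrightarrow> (\<exists>t. halts_with A d t r)"

text \<open>As \<open>tsize d \<ge> 1\<close>, every polynomial bound has the form below.\<close>

definition poly_time :: "com \<Rightarrow> bool" where
  "poly_time A \<longleftrightarrow> (\<exists>c. \<forall>d. \<exists>t r. halts_with A d t r \<and> t \<le> c * tsize d ^ c)"


section \<open>Encodings as trees\<close>

text \<open>Numbers are written in binary, least significant bit first.\<close>

fun enc_nat :: "nat \<Rightarrow> tree" where
  "enc_nat m = (if m = 0 then Atom else Dot (enc_bool (odd m)) (enc_nat (m div 2)))"

declare enc_nat.simps [simp del]

fun enc_list :: "tree list \<Rightarrow> tree" where
  "enc_list [] = Atom"
| "enc_list (d # ds) = Dot d (enc_list ds)"

definition owner :: "nat \<Rightarrow> light_form \<Rightarrow> nat \<Rightarrow> nat" where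
  "owner k L v = (THE i. i < k \<and> v \<in> part L i)"

definition enc_node :: "nat \<Rightarrow> light_form \<Rightarrow> nat \<Rightarrow> tree" where
  "enc_node k L v =
     (if v \<in> inner L
      then Dot (enc_bool True)
             (enc_list [enc_nat (owner k L v), enc_nat (child L v False), enc_nat (child L v True)])
      else Dot (enc_bool False)
             (Dot (enc_nat (fst (leaf L v))) (enc_bool (snd (leaf L v)))))"

definition enc_light :: "nat \<Rightarrow> light_form \<Rightarrow> tree" where
  "enc_light k L =
     Dot (enc_nat (start L)) (enc_list (map (enc_node k L) [0..<num_nodes L]))"

fun enc_gate :: "gate \<Rightarrow> tree" where
  "enc_gate (Lit j s) = Dot (enc_bool False) (Dot (enc_nat j) (enc_bool s))"
| "enc_gate (Thr us) = Dot (enc_bool True) (enc_list (map enc_nat us))"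

definition enc_circuit :: "circuit \<Rightarrow> tree" where
  "enc_circuit C = Dot (enc_nat (out_node C)) (enc_list (map enc_gate (gates C)))"

end

(*
  Let the k parties be played by k inputs in every possible way: for each role assignment
  phi : [k] -> [k] keep a token u_phi on a node of the protocol, starting at s.  The circuit
  maintains that every zero x of f belongs to some class r < k, meaning that for all phi and all
  i with phi(i) = r the input x is i-compatible with u_phi.  In one round class r is split into
  pieces (r, beta) according to the bits beta which its members send at the nodes u_phi.  From a
  list of more than k pieces a THR_2^{k+1} gate passes to k+1 shorter lists, each omitting one
  piece; as a zero lies in one of the pieces, at most one of the k+1 inputs of the gate is
  not known to vanish on it.  When k pieces are left they become the new classes.  If c sends a
  new class to the old class it comes from, then the new token for phi is the child of the old
  token for c o phi chosen by the bit of the piece that plays the owner of that node, so all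
  tokens move on, even if c is not injective.  Hence a round of constant depth costs one level of
  the protocol.  When the token of the identity reaches a terminal (j, b), class r is
  r-compatible with it, so the literal saying x_j = not b vanishes.

  The construction runs in polynomial time because it is composed from pairing, case distinction
  and recursion along the right spine of a tree in which each step adds only polynomially to the
  size of the result.
*)

theory Submission
  imports Defs
begin

section \<open>Polynomial-time functions on trees\<close>

definition poly_bounded :: "(tree \<Rightarrow> nat) \<Rightarrow> bool" where
  "poly_bounded F \<longleftrightarrow> (\<exists>c. \<forall>d. F d \<le> c * tsize d ^ c)"

lemma tsize_pos [simp]: "0 < tsize d"
  by (induction d) auto

lemma tsize_ge1 [simp]: "Suc 0 \<le> tsize d"
  using tsize_pos[of d] by linarith

text \<open>As \<open>tsize d\<close> is at least 1, coefficient and exponent may both be raised to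
  their sum, so ordinary polynomial bounds fit the format with a single constant.\<close>

lemma poly_bounded_I:
  assumes "\<And>d. F d \<le> a * tsize d ^ b"
  shows "poly_bounded F"
  unfolding poly_bounded_def
proof (intro exI allI)
  fix d
  have "F d \<le> a * tsize d ^ b" by (rule assms)
  also have "\<dots> \<le> (a + b) * tsize d ^ (a + b)"
    by (intro mult_mono power_increasing) (auto simp: tsize_ge1)
  finally show "F d \<le> (a + b) * tsize d ^ (a + b)" .
qed

lemma poly_bounded_mono: "poly_bounded G \<Longrightarrow> (\<And>d. F d \<le> G d) \<Longrightarrow> poly_bounded F"
  unfolding poly_bounded_def by (meson le_trans)

lemma poly_bounded_const: "poly_bounded (\<lambda>d. c)"
  by (rule poly_bounded_I[of _ c 0]) simp

lemma poly_bounded_tsize: "poly_bounded tsize"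
  by (rule poly_bounded_I[of _ 1 1]) simp

lemma poly_bounded_mult:
  assumes "poly_bounded F" "poly_bounded G"
  shows "poly_bounded (\<lambda>d. F d * G d)"
proof -
  obtain a b where a: "\<And>d. F d \<le> a * tsize d ^ a" and b: "\<And>d. G d \<le> b * tsize d ^ b"
    using assms unfolding poly_bounded_def by blast
  have "F d * G d \<le> (a * b) * tsize d ^ (a + b)" for d
    using mult_mono[OF a[of d] b[of d]] by (simp add: power_add algebra_simps)
  then show ?thesis by (rule poly_bounded_I)
qed

lemma poly_bounded_add:
  assumes "poly_bounded F" "poly_bounded G"
  shows "poly_bounded (\<lambda>d. F d + G d)"
proof -
  obtain a b where a: "\<And>d. F d \<le> a * tsize d ^ a" and b: "\<And>d. G d \<le> b * tsize d ^ b"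
    using assms unfolding poly_bounded_def by blast
  have "F d + G d \<le> (a + b) * tsize d ^ (a + b)" for d
  proof -
    have "F d \<le> a * tsize d ^ (a + b)"
      by (rule order_trans[OF a mult_le_mono2], rule power_increasing) (auto simp: tsize_ge1)
    moreover have "G d \<le> b * tsize d ^ (a + b)"
      by (rule order_trans[OF b mult_le_mono2], rule power_increasing) (auto simp: tsize_ge1)
    ultimately show ?thesis by (simp add: algebra_simps)
  qed
  then show ?thesis by (rule poly_bounded_I)
qed

lemma poly_bounded_power: "poly_bounded F \<Longrightarrow> poly_bounded (\<lambda>d. F d ^ c)"
  by (induction c) (auto intro: poly_bounded_const poly_bounded_mult)

lemma poly_bounded_comp:
  assumes "poly_bounded F" "poly_bounded (\<lambda>d. tsize (f d))"
  shows "poly_bounded (\<lambda>d. F (f d))"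
proof -
  obtain a where a: "\<And>d. F d \<le> a * tsize d ^ a" using assms(1) unfolding poly_bounded_def by blast
  show ?thesis
    by (rule poly_bounded_mono[where G = "\<lambda>d. a * tsize (f d) ^ a"])
      (auto intro!: poly_bounded_mult poly_bounded_const poly_bounded_power assms a)
qed

lemmas poly_bounded_intros = poly_bounded_const poly_bounded_tsize poly_bounded_add poly_bounded_mult poly_bounded_power

section \<open>Programs and the functions they compute in polynomial time\<close>

fun assigned :: "com \<Rightarrow> nat set" where
  "assigned Skip = {}"
| "assigned (Assign x e) = {x}"
| "assigned (Seq c c') = assigned c \<union> assigned c'"
| "assigned (Cond e c c') = assigned c \<union> assigned c'"
| "assigned (Loop e c) = assigned c"

lemma finite_assigned: "finite (assigned c)"
  by (induction c) auto

lemma exec_unassigned: "exec c s t s' \<Longrightarrow> x \<notin> assigned c \<Longrightarrow> s' x = s x"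
  by (induction rule: exec.induct) auto

lemma tsize_eval_expr: "tsize (eval_expr e s) \<le> expr_cost e s"
  by (cases e) auto

text \<open>An assignment is charged at least the size of the value it stores, so only a variable
  that still has its initial value can be larger than the running time.\<close>

lemma exec_tsize: "exec c s t s' \<Longrightarrow> s' x = s x \<or> tsize (s' x) \<le> t"
  by (induction rule: exec.induct) (auto simp: tsize_eval_expr)

text \<open>The program must work from every store, so that programs can be composed without
  resetting their auxiliary variables.\<close>

definition FP :: "(tree \<Rightarrow> tree) \<Rightarrow> bool" where
  "FP f \<longleftrightarrow> (\<exists>A T. poly_bounded T \<and> (\<forall>s. \<exists>t s'. exec A s t s' \<and> s' 0 = f (s 0) \<and> t \<le> T (s 0)))"

lemma FP_I:
  assumes "poly_bounded T" "\<And>s. \<exists>t s'. exec A s t s' \<and> s' 0 = f (s 0) \<and> t \<le> T (s 0)"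
  shows "FP f"
  using assms unfolding FP_def by blast

lemma FP_E:
  assumes "FP f"
  obtains A T where "poly_bounded T"
    "\<And>s. \<exists>t s'. exec A s t s' \<and> s' 0 = f (s 0) \<and> t \<le> T (s 0)"
  using assms unfolding FP_def by blast

text \<open>This makes composition possible: the outer program runs on an argument whose size is
  still polynomial in the original input.\<close>

lemma FP_tsize:
  assumes "FP f"
  shows "poly_bounded (\<lambda>d. tsize (f d))"
proof -
  from assms obtain A T where T: "poly_bounded T"
    and ex: "\<And>s. \<exists>t s'. exec A s t s' \<and> s' 0 = f (s 0) \<and> t \<le> T (s 0)"
    by (rule FP_E) blast
  have "tsize (f d) \<le> tsize d + T d" for d
  proof -
    obtain t s' where "exec A (\<lambda>_. d) t s'" "s' 0 = f d" "t \<le> T d"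
      using ex[of "\<lambda>_. d"] by auto
    then show ?thesis using exec_tsize[of A "\<lambda>_. d" t s' 0] by auto
  qed
  then show ?thesis by (rule poly_bounded_mono[rotated]) (intro poly_bounded_intros T)
qed

lemma FP_poly_time:
  assumes "FP f"
  shows "\<exists>A. poly_time A \<and> (\<forall>d. outputs A d (f d))"
proof -
  from assms obtain A T where T: "poly_bounded T"
    and ex: "\<And>s. \<exists>t s'. exec A s t s' \<and> s' 0 = f (s 0) \<and> t \<le> T (s 0)"
    by (rule FP_E) blast
  obtain c where c: "\<And>d. T d \<le> c * tsize d ^ c" using T unfolding poly_bounded_def by blast
  have *: "\<exists>t. halts_with A d t (f d) \<and> t \<le> T d" for d
    using ex[of "(\<lambda>_. Atom)(0 := d)"] unfolding halts_with_def by fastforce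
  have "poly_time A"
    unfolding poly_time_def using * c by (meson le_trans)
  moreover have "outputs A d (f d)" for d
    using * unfolding outputs_def by blast
  ultimately show ?thesis by blast
qed

section \<open>Closure of \<open>FP\<close> under composition, pairing and case distinction\<close>

lemma FP_id: "FP (\<lambda>d. d)"
proof (rule FP_I[of "\<lambda>_. 1" Skip])
  show "\<exists>t s'. exec Skip s t s' \<and> s' 0 = s 0 \<and> t \<le> 1" for s
    using exec.Skip[of s] by auto
qed (rule poly_bounded_const)

lemma FP_assign:
  assumes "poly_bounded T" "\<And>s. eval_expr e s = f (s 0)" "\<And>s. expr_cost e s \<le> T (s 0)"
  shows "FP f"
proof (rule FP_I[OF assms(1)])
  fix s
  show "\<exists>t s'. exec (Assign 0 e) s t s' \<and> s' 0 = f (s 0) \<and> t \<le> T (s 0)"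
    using exec.Assign[of 0 e s] assms(2,3)[of s] by fastforce
qed

lemma FP_const: "FP (\<lambda>d. c)"
  by (rule FP_assign[of "\<lambda>_. tsize c" "Quote c"]) (auto intro: poly_bounded_const)

lemma tsize_hd_le: "tsize (hd_tree d) \<le> tsize d"
  by (cases d) auto

lemma tsize_tl_le: "tsize (tl_tree d) \<le> tsize d"
  by (cases d) auto

lemma FP_hd0: "FP hd_tree"
  by (rule FP_assign[of "\<lambda>d. tsize d + tsize d" "EHd (Var 0)"])
    (auto intro!: poly_bounded_intros simp: tsize_hd_le)

lemma FP_tl0: "FP tl_tree"
  by (rule FP_assign[of "\<lambda>d. tsize d + tsize d" "ETl (Var 0)"])
    (auto intro!: poly_bounded_intros simp: tsize_tl_le)

lemma FP_comp:
  assumes "FP f" "FP g"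
  shows "FP (\<lambda>d. f (g d))"
proof -
  from assms(1) obtain A T where T: "poly_bounded T"
    and ex: "\<And>s. \<exists>t s'. exec A s t s' \<and> s' 0 = f (s 0) \<and> t \<le> T (s 0)"
    by (rule FP_E) blast
  from assms(2) obtain B U where U: "poly_bounded U"
    and ex': "\<And>s. \<exists>t s'. exec B s t s' \<and> s' 0 = g (s 0) \<and> t \<le> U (s 0)"
    by (rule FP_E) blast
  show ?thesis
  proof (rule FP_I[of "\<lambda>d. U d + T (g d)" "Seq B A"])
    show "poly_bounded (\<lambda>d. U d + T (g d))"
      by (intro poly_bounded_add U poly_bounded_comp[OF T] FP_tsize assms(2))
    fix s
    obtain t s' where 1: "exec B s t s'" "s' 0 = g (s 0)" "t \<le> U (s 0)" using ex' by blast
    obtain t' s'' where "exec A s' t' s''" "s'' 0 = f (s' 0)" "t' \<le> T (s' 0)" using ex by blast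
    with 1 show "\<exists>t s'. exec (Seq B A) s t s' \<and> s' 0 = f (g (s 0)) \<and> t \<le> U (s 0) + T (g (s 0))"
      by (metis add_mono exec.Seq)
  qed
qed

lemma fresh_var: "finite V \<Longrightarrow> \<exists>x::nat. x \<notin> V"
  by (metis ex_new_if_finite infinite_UNIV_nat)

lemma FP_Dot:
  assumes "FP f" "FP g"
  shows "FP (\<lambda>d. Dot (f d) (g d))"
proof -
  from assms(1) obtain A T where T: "poly_bounded T"
    and ex: "\<And>s. \<exists>t s'. exec A s t s' \<and> s' 0 = f (s 0) \<and> t \<le> T (s 0)"
    by (rule FP_E) blast
  from assms(2) obtain B U where U: "poly_bounded U"
    and ex': "\<And>s. \<exists>t s'. exec B s t s' \<and> s' 0 = g (s 0) \<and> t \<le> U (s 0)"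
    by (rule FP_E) blast
  \<comment> \<open>Both programs work on variable 0, so \<open>y\<close> keeps the input while
    \<open>A\<close> runs and \<open>z\<close> keeps the first result while \<open>B\<close>
    runs.\<close>
  obtain y where y: "y \<notin> assigned A \<union> assigned B \<union> {0}"
    using fresh_var finite_assigned by (meson finite.emptyI finite_UnI finite_insert)
  obtain z where z: "z \<notin> assigned B \<union> {0, y}"
    using fresh_var finite_assigned by (meson finite.emptyI finite_UnI finite_insert)
  let ?P = "Seq (Assign y (Var 0)) (Seq A (Seq (Assign z (Var 0)) (Seq (Assign 0 (Var y))
     (Seq B (Assign 0 (ECons (Var z) (Var 0)))))))"
  let ?T = "\<lambda>d. tsize d + T d + tsize (f d) + tsize d + U d +
     (tsize (f d) + tsize (g d) + (tsize (f d) + tsize (g d) + 1))"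
  show ?thesis
  proof (rule FP_I[of ?T ?P])
    show "poly_bounded ?T"
      by (intro poly_bounded_add T U poly_bounded_intros FP_tsize assms)
    fix s
    obtain t1 s1 where 1: "exec A (s(y := s 0)) t1 s1" "s1 0 = f (s 0)" "t1 \<le> T (s 0)"
      using ex[of "s(y := s 0)"] y by auto
    have y1: "s1 y = s 0" using exec_unassigned[OF 1(1), of y] y by simp
    obtain t2 s2 where 2: "exec B (s1(z := s1 0, 0 := s 0)) t2 s2" "s2 0 = g (s 0)" "t2 \<le> U (s 0)"
      using ex'[of "s1(z := s1 0, 0 := s 0)"] by auto
    have z2: "s2 z = f (s 0)" using exec_unassigned[OF 2(1), of z] z 1 by simp
    have "exec ?P s (tsize (s 0) + (t1 + (tsize (s1 0) + (tsize (s 0) + (t2 +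
       (tsize (s2 z) + tsize (s2 0) + tsize (Dot (s2 z) (s2 0)))))))) (s2(0 := Dot (s2 z) (s2 0)))"
      apply (rule exec.Seq)
      using exec.Assign[of y "Var 0" s] apply simp
      apply (rule exec.Seq[OF 1(1)])
      apply (rule exec.Seq)
      using exec.Assign[of z "Var 0" s1] apply simp
      apply (rule exec.Seq)
      using exec.Assign[of 0 "Var y" "s1(z := s1 0)"] z y1 apply simp
      apply (rule exec.Seq[OF 2(1)])
      using exec.Assign[of 0 "ECons (Var z) (Var 0)" s2] by simp
    then show "\<exists>t s'. exec ?P s t s' \<and> s' 0 = Dot (f (s 0)) (g (s 0)) \<and> t \<le> ?T (s 0)"
      using 1 2 z2 by (intro exI conjI) (assumption | simp)+
  qed
qed

lemma FP_hd: "FP f \<Longrightarrow> FP (\<lambda>d. hd_tree (f d))"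
  by (rule FP_comp[OF FP_hd0])

lemma FP_tl: "FP f \<Longrightarrow> FP (\<lambda>d. tl_tree (f d))"
  by (rule FP_comp[OF FP_tl0])

lemma FP_eq:
  assumes "FP f" "FP g"
  shows "FP (\<lambda>d. enc_bool (f d = g d))"
proof -
  have "FP (\<lambda>d. enc_bool (hd_tree d = tl_tree d))"
  proof (rule FP_assign[where e = "EEq (EHd (Var 0)) (ETl (Var 0))"])
    show "poly_bounded (\<lambda>d. tsize d + tsize d + (tsize d + tsize d) + 3)" by (intro poly_bounded_intros)
    fix s
    have "tsize (enc_bool b) \<le> 3" for b by (cases b) auto
    then show "expr_cost (EEq (EHd (Var 0)) (ETl (Var 0))) s
        \<le> tsize (s 0) + tsize (s 0) + (tsize (s 0) + tsize (s 0)) + 3"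
      using tsize_hd_le[of "s 0"] tsize_tl_le[of "s 0"] by (simp add: add_mono)
  qed simp
  from FP_comp[OF this FP_Dot[OF assms]] show ?thesis by simp
qed

text \<open>The value of the test is first paired with the input, so that a program with one input
  variable can branch on the head; each branch then discards it.\<close>

lemma FP_if_Atom:
  assumes "FP c" "FP f" "FP g"
  shows "FP (\<lambda>d. if c d = Atom then f d else g d)"
proof -
  from assms(2) obtain A T where T: "poly_bounded T"
    and ex: "\<And>s. \<exists>t s'. exec A s t s' \<and> s' 0 = f (s 0) \<and> t \<le> T (s 0)"
    by (rule FP_E) blast
  from assms(3) obtain B U where U: "poly_bounded U"
    and ex': "\<And>s. \<exists>t s'. exec B s t s' \<and> s' 0 = g (s 0) \<and> t \<le> U (s 0)"
    by (rule FP_E) blast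
  let ?l = "Assign 0 (ETl (Var 0))"
  let ?P = "Cond (EHd (Var 0)) (Seq ?l B) (Seq ?l A)"
  let ?T = "\<lambda>d. 4 * tsize d + T (tl_tree d) + U (tl_tree d)"
  have "FP (\<lambda>d. if hd_tree d = Atom then f (tl_tree d) else g (tl_tree d))"
  proof (rule FP_I[of ?T ?P])
    have "poly_bounded (\<lambda>d. tsize (tl_tree d))" by (intro FP_tsize FP_tl0)
    then show "poly_bounded ?T" by (intro poly_bounded_intros poly_bounded_comp[OF T] poly_bounded_comp[OF U])
    fix s :: store
    let ?s = "s(0 := tl_tree (s 0))"
    let ?c = "tsize (s 0) + tsize (hd_tree (s 0))"
    let ?c' = "tsize (s 0) + tsize (tl_tree (s 0))"
    have l: "exec ?l s ?c' ?s" using exec.Assign[of 0 "ETl (Var 0)" s] by simp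
    have sz: "?c \<le> 2 * tsize (s 0)" "?c' \<le> 2 * tsize (s 0)"
      using tsize_hd_le[of "s 0"] tsize_tl_le[of "s 0"] by auto
    show "\<exists>t s'. exec ?P s t s' \<and>
       s' 0 = (if hd_tree (s 0) = Atom then f (tl_tree (s 0)) else g (tl_tree (s 0))) \<and> t \<le> ?T (s 0)"
    proof (cases "hd_tree (s 0) = Atom")
      case True
      obtain t s' where 1: "exec A ?s t s'" "s' 0 = f (?s 0)" "t \<le> T (?s 0)" using ex by blast
      have "exec ?P s (?c + (?c' + t)) s'"
        using exec.CondFalse[OF _ exec.Seq[OF l 1(1)], of "EHd (Var 0)"] True by simp
      moreover have "?c + (?c' + t) \<le> ?T (s 0)" using 1(3) sz by simp
      moreover have "s' 0 = (if hd_tree (s 0) = Atom then f (tl_tree (s 0)) else g (tl_tree (s 0)))"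
        using 1(2) True by simp
      ultimately show ?thesis by blast
    next
      case False
      obtain t s' where 1: "exec B ?s t s'" "s' 0 = g (?s 0)" "t \<le> U (?s 0)" using ex' by blast
      have "exec ?P s (?c + (?c' + t)) s'"
        using exec.CondTrue[OF _ exec.Seq[OF l 1(1)], of "EHd (Var 0)"] False by simp
      moreover have "?c + (?c' + t) \<le> ?T (s 0)" using 1(3) sz by simp
      moreover have "s' 0 = (if hd_tree (s 0) = Atom then f (tl_tree (s 0)) else g (tl_tree (s 0)))"
        using 1(2) False by simp
      ultimately show ?thesis by blast
    qed
  qed
  from FP_comp[OF this FP_Dot[OF assms(1) FP_id]] show ?thesis by (simp cong: if_cong)
qed

lemma FP_if:
  assumes "FP a" "FP b" "FP f" "FP g"
  shows "FP (\<lambda>d. if a d = b d then f d else g d)"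
proof -
  \<comment> \<open>\<open>enc_bool False\<close> is \<open>Atom\<close>, hence the two branches
    change places.\<close>
  have "(if enc_bool P = Atom then y else x) = (if P then x else y)" for P and x y :: tree
    by (cases P) auto
  then show ?thesis
    using FP_if_Atom[OF FP_eq[OF assms(1,2)] assms(4,3)] by simp
qed

section \<open>Recursion along the right spine of a tree\<close>

fun trec :: "(tree \<Rightarrow> tree) \<Rightarrow> (tree \<Rightarrow> tree) \<Rightarrow> tree \<Rightarrow> tree \<Rightarrow> tree" where
  "trec a g e Atom = a e"
| "trec a g e (Dot x y) = g (Dot e (Dot (Dot x y) (trec a g e y)))"

text \<open>The spine recursion is executed bottom-up: a first loop pushes all suffixes of the
  argument on a stack, a second one pops them and updates the result.\<close>

fun suffix_stack :: "tree \<Rightarrow> tree \<Rightarrow> tree" where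
  "suffix_stack Atom z = z"
| "suffix_stack (Dot x y) z = suffix_stack y (Dot (Dot x y) z)"

text \<open>At most \<open>tsize t\<close> suffixes are pushed, none larger than \<open>t\<close>,
  which gives a quadratic bound.\<close>

lemma tsize_suffix_stack: "tsize (suffix_stack t z) \<le> tsize z + tsize t * (tsize t + 1)"
proof (induction t arbitrary: z)
  case (Dot x y)
  have "tsize (suffix_stack (Dot x y) z) \<le> tsize (Dot (Dot x y) z) + tsize y * (tsize y + 1)"
    using Dot.IH(2)[of "Dot (Dot x y) z"] by simp
  also have "\<dots> \<le> tsize z + tsize (Dot x y) * (tsize (Dot x y) + 1)"
    using tsize_pos[of x] by (simp add: algebra_simps)
  finally show ?case .
qed simp

text \<open>There are at most \<open>tsize t\<close> iterations, and the inner parenthesis bounds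
  the stack at all times; the factor 8 covers the constantly many values handled per
  iteration.\<close>

lemma exec_push_suffixes:
  assumes "X \<noteq> Z"
  shows "s X = t \<Longrightarrow> \<exists>T. exec (Loop (Var X) (Seq (Assign Z (ECons (Var X) (Var Z))) (Assign X (ETl (Var X)))))
           s T (s(X := Atom, Z := suffix_stack t (s Z)))
         \<and> T \<le> tsize t * (8 * (tsize t * (tsize t + 1) + tsize (s Z)))"
proof (induction t arbitrary: s)
  case Atom
  let ?b = "Seq (Assign Z (ECons (Var X) (Var Z))) (Assign X (ETl (Var X)))"
  have "exec (Loop (Var X) ?b) s (expr_cost (Var X) s) s"
    by (rule exec.LoopFalse) (use Atom in simp)
  moreover have "s(X := Atom, Z := s Z) = s" using Atom by (auto simp: fun_eq_iff)
  ultimately have "exec (Loop (Var X) ?b) s 1 (s(X := Atom, Z := suffix_stack Atom (s Z)))"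
    using Atom by simp
  then show ?case by - (rule exI[of _ 1], rule conjI, assumption, simp)
next
  case (Dot x y)
  let ?b = "Seq (Assign Z (ECons (Var X) (Var Z))) (Assign X (ETl (Var X)))"
  let ?t = "Dot x y"
  let ?s = "s(Z := Dot ?t (s Z), X := y)"
  have b: "exec ?b s (tsize ?t + tsize (s Z) + tsize (Dot ?t (s Z)) + (tsize ?t + tsize y)) ?s"
    apply (rule exec.Seq)
    using exec.Assign[of Z "ECons (Var X) (Var Z)" s] Dot.prems apply simp
    using exec.Assign[of X "ETl (Var X)" "s(Z := Dot ?t (s Z))"] Dot.prems assms by simp
  have "\<exists>T. exec (Loop (Var X) ?b) ?s T (?s(X := Atom, Z := suffix_stack y (?s Z)))
    \<and> T \<le> tsize y * (8 * (tsize y * (tsize y + 1) + tsize (?s Z)))"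
    by (rule Dot.IH(2)) simp
  then obtain T where T: "exec (Loop (Var X) ?b) ?s T (?s(X := Atom, Z := suffix_stack y (?s Z)))"
    "T \<le> tsize y * (8 * (tsize y * (tsize y + 1) + tsize (?s Z)))"
    by blast
  have eq: "?s(X := Atom, Z := suffix_stack y (?s Z)) = s(X := Atom, Z := suffix_stack ?t (s Z))"
    using assms by auto
  let ?T = "tsize ?t + (tsize ?t + tsize (s Z) + tsize (Dot ?t (s Z)) + (tsize ?t + tsize y)) + T"
  have "exec (Loop (Var X) ?b) s ?T (s(X := Atom, Z := suffix_stack ?t (s Z)))"
    using exec.LoopTrue[OF _ b T(1)] Dot.prems unfolding eq by simp
  moreover have "?T \<le> tsize ?t * (8 * (tsize ?t * (tsize ?t + 1) + tsize (s Z)))"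
  proof -
    let ?n = "tsize ?t" and ?m = "tsize y" and ?z = "tsize (s Z)"
    have m: "?m + 2 \<le> ?n" using tsize_pos[of x] by simp
    \<comment> \<open>The bound on the stack does not grow when one more suffix is moved onto
      it.\<close>
    have "?m * (?m + 1) + (?n + ?z + 1) \<le> ?n * (?n + 1) + ?z"
    proof -
      have "?m * (?m + 1) + ?n + 1 \<le> (?m + 1) * (?n + 1)"
        using m by (simp add: algebra_simps)
      also have "\<dots> \<le> ?n * (?n + 1)" by (rule mult_le_mono1) (use m in simp)
      finally show ?thesis by simp
    qed
    then have "T \<le> ?m * (8 * (?n * (?n + 1) + ?z))"
      using T(2) assms by (elim order_trans) (simp add: mult_le_mono2)
    moreover have "4 * ?n + 2 * ?z + 1 + ?m \<le> 8 * (?n * (?n + 1) + ?z)"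
      using m tsize_pos[of x] tsize_pos[of y] by (simp add: algebra_simps)
    moreover have "(?m + 1) * (8 * (?n * (?n + 1) + ?z)) \<le> ?n * (8 * (?n * (?n + 1) + ?z))"
      by (rule mult_le_mono1) (use m in simp)
    ultimately show ?thesis by (simp add: algebra_simps)
  qed
  ultimately show ?case by blast
qed


lemma tsize_suffix_stack_ge: "tsize z \<le> tsize (suffix_stack t z)"
proof (induction t arbitrary: z)
  case (Dot x y)
  show ?case using Dot.IH(2)[of "Dot (Dot x y) z"] by simp
qed simp

text \<open>The loop pops the shortest suffix first, while the induction peels \<open>t\<close> from
  its longest. Hence the continuation form: if the loop needs time at most \<open>N\<close> from
  stack \<open>z\<close> and the result for \<open>t\<close>, then each spine node of
  \<open>t\<close> adds at most \<open>B\<close>. The bound \<open>r\<close> controls all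
  intermediate results.\<close>

lemma exec_pop_suffixes:
  fixes A :: com and B c m n r :: nat
  assumes A: "\<And>s. \<exists>t s'. exec A s t s' \<and> s' 0 = g (s 0) \<and> t \<le> c * tsize (s 0) ^ c"
    and fresh: "E \<notin> assigned A" "Z \<notin> assigned A" "E \<noteq> 0" "Z \<noteq> 0" "E \<noteq> Z"
    and r: "\<And>y. tsize y \<le> n \<Longrightarrow> tsize (trec a g e y) \<le> r"
  defines "L \<equiv> Loop (Var Z) (Seq (Assign 0 (ECons (Var E) (ECons (EHd (Var Z)) (Var 0))))
                                (Seq A (Assign Z (ETl (Var Z)))))"
    and "B \<equiv> 4 * m + 2 * tsize e + 3 * n + 3 * r + 3 + c * (tsize e + n + r + 2) ^ c"
  assumes "tsize t \<le> n" "tsize (suffix_stack t z) \<le> m"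
    and "\<And>s. s E = e \<Longrightarrow> s Z = z \<Longrightarrow> s 0 = trec a g e t \<Longrightarrow> \<exists>T s'. exec L s T s' \<and> s' 0 = v \<and> T \<le> N"
    and "s E = e" "s Z = suffix_stack t z" "s 0 = a e"
  shows "\<exists>T s'. exec L s T s' \<and> s' 0 = v \<and> T \<le> N + tsize t * B"
  using assms(10-)
proof (induction t arbitrary: z N s)
  case Atom
  then obtain T s' where "exec L s T s'" "s' 0 = v" "T \<le> N" by fastforce
  then show ?case by fastforce
next
  case (Dot x y)
  let ?t = "Dot x y"
  have sy: "tsize y \<le> n" using Dot.prems(1) by simp
  have sm: "tsize (Dot ?t z) \<le> m"
    using tsize_suffix_stack_ge[of "Dot ?t z" y] Dot.prems(2) by simp
  \<comment> \<open>One iteration pops \<open>?t\<close> and turns the result for \<open>y\<close>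
    into the result for \<open>?t\<close>; this is the continuation to which the induction
    hypothesis for \<open>y\<close> is applied.\<close>
  have step: "\<exists>T s'. exec L s T s' \<and> s' 0 = v \<and> T \<le> N + B"
    if s: "s E = e" "s Z = Dot ?t z" "s 0 = trec a g e y" for s
  proof -
    let ?R = "trec a g e y"
    let ?c = "Assign 0 (ECons (Var E) (ECons (EHd (Var Z)) (Var 0)))"
    let ?d = "Dot e (Dot ?t ?R)"
    let ?s1 = "s(0 := ?d)"
    have 1: "exec ?c s (tsize e + (tsize (Dot ?t z) + tsize ?t + tsize ?R + tsize (Dot ?t ?R)) + tsize ?d) ?s1"
      using exec.Assign[of 0 "ECons (Var E) (ECons (EHd (Var Z)) (Var 0))" s] s by simp
    obtain t2 s2 where 2: "exec A ?s1 t2 s2" "s2 0 = g ?d" "t2 \<le> c * tsize ?d ^ c"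
      using A[of ?s1] by auto
    have s2: "s2 E = e" "s2 Z = Dot ?t z"
      using exec_unassigned[OF 2(1)] fresh s by auto
    let ?s3 = "s2(Z := z)"
    have 3: "exec (Assign Z (ETl (Var Z))) s2 (tsize (Dot ?t z) + tsize z) ?s3"
      using exec.Assign[of Z "ETl (Var Z)" s2] s2 by simp
    have "\<exists>T s'. exec L ?s3 T s' \<and> s' 0 = v \<and> T \<le> N"
      by (rule Dot.prems(3)) (use s2 2(2) fresh in auto)
    then obtain T s' where 4: "exec L ?s3 T s'" "s' 0 = v" "T \<le> N" by blast
    let ?T = "tsize (Dot ?t z) + ((tsize e + (tsize (Dot ?t z) + tsize ?t + tsize ?R + tsize (Dot ?t ?R)) + tsize ?d)
      + (t2 + (tsize (Dot ?t z) + tsize z))) + T"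
    have "exec L s ?T s'"
      unfolding L_def
      using exec.LoopTrue[OF _ exec.Seq[OF 1 exec.Seq[OF 2(1) 3]] 4(1)[unfolded L_def]] s by simp
    moreover have "?T \<le> N + B"
    proof -
      have R: "tsize ?R \<le> r" by (rule r[OF sy])
      have "tsize ?d ^ c \<le> (tsize e + n + r + 2) ^ c"
        by (rule power_mono) (use R Dot.prems(1) in auto)
      then have "t2 \<le> c * (tsize e + n + r + 2) ^ c"
        using 2(3) by (meson le_trans mult_le_mono2)
      then show ?thesis
        using R Dot.prems(1) sm 4(3) unfolding B_def by simp
    qed
    ultimately show ?thesis using 4(2) by blast
  qed
  have "\<exists>T s'. exec L s T s' \<and> s' 0 = v \<and> T \<le> (N + B) + tsize y * B"
    by (rule Dot.IH(2)[OF sy]) (use Dot.prems step in auto)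
  then show ?case
    using tsize_pos[of x] by (fastforce simp: algebra_simps)
qed

lemma FP_trec:
  assumes "FP a" "FP g"
    and size: "poly_bounded (\<lambda>d. tsize (trec a g (hd_tree d) (tl_tree d)))"
  shows "FP (\<lambda>d. trec a g (hd_tree d) (tl_tree d))"
proof -
  from assms(1) obtain A T where T: "poly_bounded T"
    and A: "\<And>s. \<exists>t s'. exec A s t s' \<and> s' 0 = a (s 0) \<and> t \<le> T (s 0)"
    by (rule FP_E) blast
  from assms(2) obtain G U where U: "poly_bounded U"
    and G: "\<And>s. \<exists>t s'. exec G s t s' \<and> s' 0 = g (s 0) \<and> t \<le> U (s 0)"
    by (rule FP_E) blast
  obtain c where "\<And>d. U d \<le> c * tsize d ^ c" using U unfolding poly_bounded_def by blast
  with G have G': "\<And>s. \<exists>t s'. exec G s t s' \<and> s' 0 = g (s 0) \<and> t \<le> c * tsize (s 0) ^ c"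
    by (meson le_trans)
  obtain q where q: "\<And>d. tsize (trec a g (hd_tree d) (tl_tree d)) \<le> q * tsize d ^ q"
    using size unfolding poly_bounded_def by blast
  obtain E where E: "E \<notin> assigned A \<union> assigned G \<union> {0}"
    using fresh_var finite_assigned by (meson finite.emptyI finite_UnI finite_insert)
  obtain Z where Z: "Z \<notin> assigned A \<union> assigned G \<union> {0, E}"
    using fresh_var finite_assigned by (meson finite.emptyI finite_UnI finite_insert)
  obtain X where X: "X \<notin> {0, E, Z}"
    using fresh_var by (meson finite.emptyI finite_insert)
  let ?L1 = "Loop (Var X) (Seq (Assign Z (ECons (Var X) (Var Z))) (Assign X (ETl (Var X))))"
  let ?L2 = "Loop (Var Z) (Seq (Assign 0 (ECons (Var E) (ECons (EHd (Var Z)) (Var 0))))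
                                (Seq G (Assign Z (ETl (Var Z)))))"
  let ?P = "Seq (Assign E (EHd (Var 0))) (Seq (Assign X (ETl (Var 0))) (Seq (Assign Z (Quote Atom))
     (Seq ?L1 (Seq (Assign 0 (Var E)) (Seq A ?L2)))))"
  \<comment> \<open>\<open>2 * tsize d + 1\<close> bounds the size of \<open>Dot e y\<close> for
    every suffix \<open>y\<close>, so the assumed size bound on final results also controls the
    intermediate ones.\<close>
  let ?r = "\<lambda>d. q * (2 * tsize d + 1) ^ q"
  let ?m = "\<lambda>d. 1 + tsize d * (tsize d + 1)"
  let ?B = "\<lambda>d. 4 * ?m d + 2 * tsize d + 3 * tsize d + 3 * ?r d + 3
      + c * (tsize d + tsize d + ?r d + 2) ^ c"
  let ?T = "\<lambda>d. 2 * tsize d + 2 * tsize d + 1 + tsize d * (8 * ?m d) + tsize d + T (hd_tree d)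
     + (1 + tsize d * ?B d)"
  show ?thesis
  proof (rule FP_I[of ?T ?P])
    have "poly_bounded (\<lambda>d. tsize (hd_tree d))" by (intro FP_tsize FP_hd0)
    then show "poly_bounded ?T" by (intro poly_bounded_intros poly_bounded_comp[OF T])
    fix s :: store
    let ?d = "s 0" let ?e = "hd_tree ?d" and ?t = "tl_tree ?d"
    have e: "tsize ?e \<le> tsize ?d" and t: "tsize ?t \<le> tsize ?d"
      by (rule tsize_hd_le tsize_tl_le)+
    let ?s3 = "s(E := ?e, X := ?t, Z := Atom)"
    have c1: "exec (Assign E (EHd (Var 0))) s (tsize ?d + tsize ?e) (s(E := ?e))"
      using exec.Assign[of E "EHd (Var 0)" s] by simp
    have c2: "exec (Assign X (ETl (Var 0))) (s(E := ?e)) (tsize ?d + tsize ?t) (s(E := ?e, X := ?t))"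
      using exec.Assign[of X "ETl (Var 0)" "s(E := ?e)"] E by simp
    have c3: "exec (Assign Z (Quote Atom)) (s(E := ?e, X := ?t)) 1 ?s3"
      using exec.Assign[of Z "Quote Atom" "s(E := ?e, X := ?t)"] by simp
    let ?s4 = "?s3(X := Atom, Z := suffix_stack ?t Atom)"
    have XZ: "X \<noteq> Z" using X by simp
    obtain t4 where c4: "exec ?L1 ?s3 t4 ?s4" "t4 \<le> tsize ?t * (8 * (tsize ?t * (tsize ?t + 1) + 1))"
      using exec_push_suffixes[OF XZ, of ?s3 ?t] XZ by auto
    let ?s5 = "?s4(0 := ?e)"
    have s4: "?s4 E = ?e" using E Z X by simp
    have c5: "exec (Assign 0 (Var E)) ?s4 (tsize ?e) ?s5"
      using exec.Assign[of 0 "Var E" ?s4] unfolding eval_expr.simps expr_cost.simps s4 .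
    obtain t6 s6 where c6: "exec A ?s5 t6 s6" "s6 0 = a ?e" "t6 \<le> T ?e"
      using A[of ?s5] by auto
    have s6: "s6 E = ?e" "s6 Z = suffix_stack ?t Atom"
      using exec_unassigned[OF c6(1)] E Z X by auto
    have "\<exists>t' s'. exec ?L2 s6 t' s' \<and> s' 0 = trec a g ?e ?t \<and> t' \<le> 1 + tsize ?t *
       (4 * ?m ?d + 2 * tsize ?e + 3 * tsize ?d + 3 * ?r ?d + 3
      + c * (tsize ?e + tsize ?d + ?r ?d + 2) ^ c)"
    proof (rule exec_pop_suffixes[where A = G and g = g and c = c and a = a and n = "tsize ?d"
          and z = Atom and m = "?m ?d" and r = "?r ?d"])
      show "\<exists>t s'. exec G s t s' \<and> s' 0 = g (s 0) \<and> t \<le> c * tsize (s 0) ^ c" for s by (rule G')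
      show "tsize (trec a g ?e y) \<le> ?r ?d" if "tsize y \<le> tsize ?d" for y
      proof -
        have "tsize (trec a g ?e y) \<le> q * tsize (Dot ?e y) ^ q" using q[of "Dot ?e y"] by simp
        also have "\<dots> \<le> ?r ?d" by (intro mult_le_mono2 power_mono) (use that e in auto)
        finally show ?thesis .
      qed
      have "tsize (suffix_stack ?t Atom) \<le> 1 + tsize ?t * (tsize ?t + 1)"
        using tsize_suffix_stack[of ?t Atom] by simp
      also have "\<dots> \<le> ?m ?d" by (intro add_mono mult_mono) (use t in auto)
      finally show "tsize (suffix_stack ?t Atom) \<le> ?m ?d" .
      \<comment> \<open>At the bottom of the stack the test reads \<open>Atom\<close> at cost 1,
        which is the initial continuation.\<close>
      show "\<exists>T s''. exec ?L2 s' T s'' \<and> s'' 0 = trec a g ?e ?t \<and> T \<le> 1"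
        if "s' Z = Atom" "s' 0 = trec a g ?e ?t" for s'
        using exec.LoopFalse[of "Var Z" s'] that by fastforce
    qed (use E Z t s6 c6(2) in auto)
    then obtain t7 s7 where c7: "exec ?L2 s6 t7 s7" "s7 0 = trec a g ?e ?t" "t7 \<le> 1 + tsize ?t *
       (4 * ?m ?d + 2 * tsize ?e + 3 * tsize ?d + 3 * ?r ?d + 3
      + c * (tsize ?e + tsize ?d + ?r ?d + 2) ^ c)" by blast
    have t7: "t7 \<le> 1 + tsize ?d * ?B ?d"
      by (rule order_trans[OF c7(3)], intro add_mono mult_mono power_mono) (use e t in auto)
    have t4: "t4 \<le> tsize ?d * (8 * ?m ?d)"
    proof (rule order_trans[OF c4(2)], rule mult_le_mono[OF t], rule mult_le_mono2)
      show "tsize ?t * (tsize ?t + 1) + 1 \<le> ?m ?d"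
        using mult_le_mono[OF t, of "tsize ?t + 1" "tsize ?d + 1"] t by simp
    qed
    have "exec ?P s ((tsize ?d + tsize ?e) + ((tsize ?d + tsize ?t) + (1 + (t4 + (tsize ?e + (t6 + t7)))))) s7"
      by (intro exec.Seq[OF c1] exec.Seq[OF c2] exec.Seq[OF c3] exec.Seq[OF c4(1)]
          exec.Seq[OF c5] exec.Seq[OF c6(1)] c7(1))
    moreover have "(tsize ?d + tsize ?e) + ((tsize ?d + tsize ?t) + (1 + (t4 + (tsize ?e + (t6 + t7))))) \<le> ?T ?d"
      using t4 t7 c6(3) e t by linarith
    ultimately show "\<exists>t s'. exec ?P s t s' \<and> s' 0 = trec a g ?e ?t \<and> t \<le> ?T ?d"
      using c7(2) by blast
  qed
qed

text \<open>A step may enlarge the recursive result only by an amount polynomial in the parameter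
  and the current suffix, whatever that result is. Sizes therefore add up along the spine instead of
  multiplying.\<close>

lemma FP_rec:
  assumes F: "\<And>e. F e Atom = a e" "\<And>e x y. F e (Dot x y) = G e x y (F e y)"
    and "FP a"
    and G: "FP (\<lambda>p. G (hd_tree p) (hd_tree (hd_tree (tl_tree p))) (tl_tree (hd_tree (tl_tree p)))
                   (tl_tree (tl_tree p)))"
    and P: "poly_bounded P" "\<And>e x y r. tsize (G e x y r) \<le> tsize r + P (Dot e (Dot x y))"
    and "FP f" "FP h"
  shows "FP (\<lambda>d. F (f d) (h d))"
proof -
  let ?g = "\<lambda>p. G (hd_tree p) (hd_tree (hd_tree (tl_tree p))) (tl_tree (hd_tree (tl_tree p)))
                   (tl_tree (tl_tree p))"
  have eq: "F e t = trec a ?g e t" for e t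
    by (induction t) (simp_all add: F)
  obtain c where c: "\<And>d. P d \<le> c * tsize d ^ c" using P(1) unfolding poly_bounded_def by blast
  \<comment> \<open>\<open>n\<close> stays fixed while \<open>t\<close> shrinks, so all steps share
    one bound.\<close>
  have b: "tsize (F e t) \<le> tsize (a e) + tsize t * (c * (tsize e + n + 1) ^ c)"
    if "tsize t \<le> n" for e t n
    using that
  proof (induction t)
    case Atom
    then show ?case by (simp add: F)
  next
    case (Dot x y)
    have "tsize (F e (Dot x y)) \<le> tsize (F e y) + P (Dot e (Dot x y))" by (simp add: F P(2))
    also have "P (Dot e (Dot x y)) \<le> c * (tsize e + n + 1) ^ c"
      by (rule order_trans[OF c], intro mult_le_mono2 power_mono) (use Dot.prems in auto)
    also have "tsize (F e y) \<le> tsize (a e) + tsize y * (c * (tsize e + n + 1) ^ c)"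
      using Dot by simp
    finally show ?case by (simp add: algebra_simps)
  qed
  have "FP (\<lambda>d. trec a ?g (hd_tree d) (tl_tree d))"
  proof (rule FP_trec[OF assms(3) G])
    have "poly_bounded (\<lambda>d. tsize (a (hd_tree d)))" by (intro FP_tsize FP_comp[OF assms(3)] FP_hd0)
    then have "poly_bounded (\<lambda>d. tsize (a (hd_tree d)) + tsize d * (c * (2 * tsize d + 1) ^ c))"
      by (intro poly_bounded_intros)
    then show "poly_bounded (\<lambda>d. tsize (trec a ?g (hd_tree d) (tl_tree d)))"
    proof (rule poly_bounded_mono)
      fix d
      have "tsize (F (hd_tree d) (tl_tree d))
        \<le> tsize (a (hd_tree d)) + tsize (tl_tree d) * (c * (tsize (hd_tree d) + tsize d + 1) ^ c)"
        by (rule b) (rule tsize_tl_le)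
      also have "\<dots> \<le> tsize (a (hd_tree d)) + tsize d * (c * (2 * tsize d + 1) ^ c)"
        using tsize_hd_le[of d] tsize_tl_le[of d] by (intro add_mono mult_mono power_mono) auto
      finally show "tsize (trec a ?g (hd_tree d) (tl_tree d))
        \<le> tsize (a (hd_tree d)) + tsize d * (c * (2 * tsize d + 1) ^ c)" by (simp add: eq)
    qed
  qed
  from FP_comp[OF this FP_Dot[OF assms(7,8)]] show ?thesis by (simp add: eq)
qed

section \<open>The circuit of a protocol\<close>

text \<open>The index of the first occurrence; junk (the length of the list) if there is none.\<close>

fun position :: "'a \<Rightarrow> 'a list \<Rightarrow> nat" where
  "position x [] = 0"
| "position x (y # ys) = (if y = x then 0 else Suc (position x ys))"

lemma position:
  assumes "x \<in> set xs"
  shows position_less: "position x xs < length xs" and nth_position: "xs ! position x xs = x"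
  using assms by (induction xs) auto

text \<open>A role assignment is the value list of a map from parties to classes: party
  \<open>i\<close> receives class \<open>\<phi> ! i\<close>, and \<open>[0..<k]\<close> is the
  identity.\<close>

definition roles :: "nat \<Rightarrow> nat list list" where
  "roles k = List.n_lists k [0..<k]"

text \<open>In a piece \<open>(r, \<beta>)\<close> the bits of \<open>\<beta>\<close> are indexed by the positions in \<open>roles k\<close>.\<close>

definition pieces :: "nat \<Rightarrow> (nat \<times> bool list) list" where
  "pieces k = List.product [0..<k] (List.n_lists (length (roles k)) [False, True])"

text \<open>A round never leaves these lists. They depend on \<open>k\<close> alone, so listing more
  than a round visits costs only a constant factor.\<close>

definition stages :: "nat \<Rightarrow> (nat \<times> bool list) list list" where
  "stages k = concat (map (\<lambda>l. List.n_lists l (pieces k)) [k..<Suc (length (pieces k))])"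

definition states :: "nat \<Rightarrow> light_form \<Rightarrow> nat list list" where
  "states k L = List.n_lists (length (roles k)) (rev [0..<num_nodes L])"

text \<open>The gates are indexed by the pairs of a state and the list of its remaining pieces.
  The states are listed in the order in which the algorithm finds the nodes in its table.\<close>

definition keys :: "nat \<Rightarrow> light_form \<Rightarrow> (nat list \<times> (nat \<times> bool list) list) list" where
  "keys k L = List.product (states k L) (stages k)"

definition token :: "nat \<Rightarrow> nat list \<Rightarrow> nat list \<Rightarrow> nat" where
  "token k U \<phi> = U ! position \<phi> (roles k)"

text \<open>At the end of a round piece \<open>S ! j\<close> becomes class \<open>j\<close>, so
  \<open>\<psi>\<close> is \<open>\<phi>\<close> expressed in the old classes. A token at a terminal
  stays there while others go on.\<close>

definition advance :: "nat \<Rightarrow> light_form \<Rightarrow> nat list \<Rightarrow> (nat \<times> bool list) list \<Rightarrow> nat list" where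
  "advance k L U S = map (\<lambda>\<phi>.
     let \<psi> = map (\<lambda>j. fst (S ! j)) \<phi>; u = token k U \<psi>
     in if u \<in> inner L then child L u (snd (S ! (\<phi> ! owner k L u)) ! position \<psi> (roles k)) else u)
   (roles k)"

text \<open>A gate with \<open>k + 1\<close> equal inputs is the identity, as \<open>k + 1 \<ge> 2\<close>.\<close>

definition succs :: "nat \<Rightarrow> light_form \<Rightarrow> nat list \<Rightarrow> (nat \<times> bool list) list
    \<Rightarrow> (nat list \<times> (nat \<times> bool list) list) list" where
  "succs k L U S =
     (if length S > k then map (\<lambda>i. (U, take i S @ drop (Suc i) S)) [0..<Suc k]
      else replicate (Suc k) (advance k L U S, pieces k))"

text \<open>The token of the identity alone decides between gate and literal; other tokens may have
  stopped earlier or may still be able to move.\<close>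

definition key_gate :: "nat \<Rightarrow> light_form \<Rightarrow> nat list \<Rightarrow> (nat \<times> bool list) list \<Rightarrow> gate" where
  "key_gate k L U S = (let u = token k U [0..<k] in
     if u \<in> inner L then Thr (map (\<lambda>K. position K (keys k L)) (succs k L U S))
     else Lit (fst (leaf L u)) (\<not> snd (leaf L u)))"

definition protocol_circuit :: "nat \<Rightarrow> light_form \<Rightarrow> circuit" where
  "protocol_circuit k L =
     \<lparr>gates = map (\<lambda>(U, S). key_gate k L U S) (keys k L),
      out_node = position (replicate (length (roles k)) (start L), pieces k) (keys k L)\<rparr>"

section \<open>Index sets of the circuit\<close>

lemma set_roles: "set (roles k) = {\<phi>. length \<phi> = k \<and> set \<phi> \<subseteq> {..<k}}"
  by (auto simp: roles_def set_n_lists)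

lemma set_pieces: "set (pieces k) = {(r, \<beta>). r < k \<and> length \<beta> = length (roles k)}"
  by (auto simp: pieces_def set_n_lists)

lemma length_pieces_ge: "k \<le> length (pieces k)"
  by (simp add: pieces_def length_n_lists)

lemma set_stages:
  "set (stages k) = {S. set S \<subseteq> set (pieces k) \<and> k \<le> length S \<and> length S \<le> length (pieces k)}"
  by (auto simp: stages_def set_n_lists)

lemma set_keys: "(U, S) \<in> set (keys k L) \<longleftrightarrow>
   length U = length (roles k) \<and> set U \<subseteq> {..<num_nodes L} \<and> S \<in> set (stages k)"
  by (auto simp: keys_def states_def set_n_lists)

lemma token_in: "length U = length (roles k) \<Longrightarrow> \<phi> \<in> set (roles k) \<Longrightarrow> token k U \<phi> \<in> set U"
  by (simp add: token_def position)

lemma token_map: "\<phi> \<in> set (roles k) \<Longrightarrow> token k (map f (roles k)) \<phi> = f \<phi>"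
  by (simp add: token_def position)

lemma comp_roles:
  assumes "S \<in> set (stages k)" "\<phi> \<in> set (roles k)"
  shows "map (\<lambda>j. fst (S ! j)) \<phi> \<in> set (roles k)"
proof -
  have "fst (S ! j) < k" if "j \<in> set \<phi>" for j
  proof -
    have "j < length S" using that assms by (auto simp: set_roles set_stages)
    then have "S ! j \<in> set (pieces k)" using assms(1) nth_mem[of j S] by (auto simp: set_stages simp del: nth_mem)
    then show ?thesis by (auto simp: set_pieces)
  qed
  then show ?thesis using assms(2) by (auto simp: set_roles)
qed

lemma dag_protocolD:
  assumes "dag_protocol k n L"
  shows "start L < num_nodes L" "inner L \<subseteq> {..<num_nodes L}"
    "\<forall>v\<in>inner L. \<forall>b. child L v b < num_nodes L"
    "acyclic {(v, child L v b) | v b. v \<in> inner L}"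
    "(\<Union>i<k. part L i) = inner L"
    "\<forall>i<k. \<forall>j<k. i \<noteq> j \<longrightarrow> part L i \<inter> part L j = {}"
    "\<forall>t\<in>terminals L. fst (leaf L t) < n"
  using assms[unfolded dag_protocol_def] by - (elim conjE, assumption)+

section \<open>Heights of nodes and the measure that decreases along wires\<close>

definition height :: "light_form \<Rightarrow> nat \<Rightarrow> nat" where
  "height L u = Max {length es | es v. path L u es v}"

lemma path_inner:
  "path L u es v \<longleftrightarrow> (es = [] \<and> u = v) \<or>
     (\<exists>b es'. u \<in> inner L \<and> es = (u, b) # es' \<and> path L (child L u b) es' v)"
  by (cases es) auto

text \<open>Without finiteness the maximum in \<open>height\<close> would say nothing. Edges form a
  finite acyclic relation, so induction can run from the terminals upwards.\<close>

lemma finite_path_lengths: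
  assumes "dag_protocol k n L"
  shows "finite {length es | es v. path L u es v}"
proof -
  let ?E = "{(v, child L v b) | v b. v \<in> inner L}"
  have "finite (inner L)" using dag_protocolD(2)[OF assms] by (rule finite_subset) simp
  then have "finite ((\<lambda>(v, b). (v, child L v b)) ` (inner L \<times> UNIV))" by simp
  then have "finite ?E" by (rule rev_finite_subset) auto
  then have "wf (?E\<inverse>)"
    by (rule finite_acyclic_wf_converse[OF _ dag_protocolD(4)[OF assms]])
  then show ?thesis
  proof (induction u rule: wf_induct_rule)
    case (less u)
    let ?P = "\<lambda>u. {length es | es v. path L u es v}"
    have "?P u \<subseteq> insert 0 (\<Union>b\<in>(if u \<in> inner L then UNIV else {}). Suc ` ?P (child L u b))"
    proof
      fix m assume "m \<in> ?P u"
      then obtain es v where es: "m = length es" "path L u es v" by blast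
      show "m \<in> insert 0 (\<Union>b\<in>(if u \<in> inner L then UNIV else {}). Suc ` ?P (child L u b))"
      proof (cases es)
        case (Cons e es')
        then obtain b where b: "u \<in> inner L" "path L (child L u b) es' v" "m = Suc (length es')"
          using es by (cases e) auto
        then have "m \<in> Suc ` ?P (child L u b)" by blast
        then show ?thesis using b(1) by auto
      qed (use es(1) in simp)
    qed
    moreover have "finite (?P (child L u b))" if "u \<in> inner L" for b
      using less that by blast
    then have "finite (insert 0 (\<Union>b\<in>(if u \<in> inner L then UNIV else {}). Suc ` ?P (child L u b)))"
      by auto
    ultimately show ?case by (rule finite_subset)
  qed
qed

lemma height_child:
  assumes "dag_protocol k n L" "u \<in> inner L"
  shows "height L (child L u b) < height L u"
proof -
  let ?P = "\<lambda>u. {length es | es v. path L u es v}"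
  note fin = finite_path_lengths[OF assms(1)]
  have "path L (child L u b) [] (child L u b)" by simp
  then have "?P (child L u b) \<noteq> {}" by blast
  then have "Max (?P (child L u b)) \<in> ?P (child L u b)" by (rule Max_in[OF fin])
  then obtain es v where *: "Max (?P (child L u b)) = length es" "path L (child L u b) es v" by auto
  then have "path L u ((u, b) # es) v" using assms(2) by simp
  then have "length ((u, b) # es) \<in> ?P u" by blast
  then have "length ((u, b) # es) \<le> Max (?P u)" by (rule Max_ge[OF fin])
  then show ?thesis unfolding height_def using * by simp
qed

lemma height_terminal: "u \<notin> inner L \<Longrightarrow> height L u = 0"
proof -
  assume u: "u \<notin> inner L"
  have "path L u es v \<longleftrightarrow> es = [] \<and> u = v" for es v
    using u by (subst path_inner) simp
  then show ?thesis by (simp add: height_def)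
qed

text \<open>A number with two digits: the greatest height of a token leads, the number of remaining
  pieces follows. Its fall along wires yields acyclicity, the evaluation order and the depth
  bound.\<close>

definition rank :: "nat \<Rightarrow> light_form \<Rightarrow> nat list \<times> (nat \<times> bool list) list \<Rightarrow> nat" where
  "rank k L K = Max (height L ` set (fst K)) * Suc (length (pieces k)) + length (snd K)"

section \<open>Shape, depth and size of the circuit\<close>

context
  fixes k n :: nat and L :: light_form
  assumes k: "k \<ge> 2" and dag: "dag_protocol k n L"
begin

lemma child_less: "u \<in> inner L \<Longrightarrow> child L u b < num_nodes L"
  using dag_protocolD(3)[OF dag] by simp

lemma owner_iff:
  assumes "u \<in> inner L" "i < k"
  shows "u \<in> part L i \<longleftrightarrow> owner k L u = i" and owner_less: "owner k L u < k"
proof -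
  obtain j where j: "j < k" "u \<in> part L j" using dag_protocolD(5)[OF dag] assms(1) by blast
  have uniq: "j' = j" if "j' < k" "u \<in> part L j'" for j'
    using dag_protocolD(6)[OF dag] j that by blast
  have "owner k L u = j" unfolding owner_def by (rule the_equality) (use j uniq in blast)+
  then show "u \<in> part L i \<longleftrightarrow> owner k L u = i" "owner k L u < k" using j uniq[OF assms(2)] by auto
qed

lemma id_role: "[0..<k] \<in> set (roles k)"
  by (auto simp: set_roles)

lemma roles_nonempty: "0 < length (roles k)"
  using id_role by (cases "roles k") auto

lemma pieces_stage: "pieces k \<in> set (stages k)"
  using length_pieces_ge by (simp add: set_stages)

lemma start_key: "(replicate (length (roles k)) (start L), pieces k) \<in> set (keys k L)"
  using dag_protocolD(1)[OF dag] pieces_stage by (auto simp: set_keys)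

lemma set_advance:
  assumes "(U, S) \<in> set (keys k L)" "w \<in> set (advance k L U S)"
  shows "w \<in> set U \<and> w \<notin> inner L \<or> (\<exists>u\<in>set U. u \<in> inner L \<and> (\<exists>b. w = child L u b))"
proof -
  have U: "length U = length (roles k)" and S: "S \<in> set (stages k)"
    using assms(1) unfolding set_keys by auto
  obtain \<phi> where \<phi>: "\<phi> \<in> set (roles k)"
    "w = (let \<psi> = map (\<lambda>j. fst (S ! j)) \<phi>; u = token k U \<psi>
     in if u \<in> inner L then child L u (snd (S ! (\<phi> ! owner k L u)) ! position \<psi> (roles k)) else u)"
    using assms(2) unfolding advance_def by auto
  have "token k U (map (\<lambda>j. fst (S ! j)) \<phi>) \<in> set U"
    by (rule token_in[OF U comp_roles[OF S \<phi>(1)]])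
  then show ?thesis unfolding \<phi>(2) Let_def by (auto split: if_split)
qed

lemma succs_key:
  assumes "(U, S) \<in> set (keys k L)" "K \<in> set (succs k L U S)"
  shows "K \<in> set (keys k L)"
proof (cases "length S > k")
  case True
  then obtain i where i: "i < Suc k" "K = (U, take i S @ drop (Suc i) S)"
    using assms(2) unfolding succs_def by (auto simp del: upt_Suc)
  have "set (take i S @ drop (Suc i) S) \<subseteq> set S"
    using set_take_subset[of i S] set_drop_subset[of "Suc i" S] by auto
  then show ?thesis using assms(1) True i by (auto simp: set_keys set_stages)
next
  case False
  then have K: "K = (advance k L U S, pieces k)" using assms(2) unfolding succs_def by auto
  have "w < num_nodes L" if "w \<in> set (advance k L U S)" for w
    using set_advance[OF assms(1) that] child_less assms(1) by (auto simp: set_keys)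
  moreover have "length (advance k L U S) = length (roles k)" by (simp add: advance_def)
  ultimately show ?thesis unfolding K set_keys using pieces_stage by auto
qed

lemma succs_rank:
  assumes "(U, S) \<in> set (keys k L)" "K \<in> set (succs k L U S)" "token k U [0..<k] \<in> inner L"
  shows "rank k L K < rank k L (U, S)"
proof (cases "length S > k")
  case True
  then obtain i where i: "i < Suc k" "K = (U, take i S @ drop (Suc i) S)"
    using assms(2) unfolding succs_def by (auto simp del: upt_Suc)
  then show ?thesis using True by (simp add: rank_def)
next
  case False
  then have K: "K = (advance k L U S, pieces k)" using assms(2) unfolding succs_def by auto
  have U: "length U = length (roles k)" using assms(1) unfolding set_keys by auto
  have le: "height L u \<le> Max (height L ` set U)" if "u \<in> set U" for u using that by simp
  \<comment> \<open>The token of the identity is at an inner node, so the maximum is positive. Hence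
    tokens resting at terminals, of height 0, also lie below it.\<close>
  have pos: "0 < Max (height L ` set U)"
    using le[OF token_in[OF U id_role]] height_child[OF dag assms(3), of False] by linarith
  have "height L w < Max (height L ` set U)" if "w \<in> set (advance k L U S)" for w
    using set_advance[OF assms(1) that] le height_child[OF dag] height_terminal pos
    by (metis order_less_le_trans)
  moreover have "set (advance k L U S) \<noteq> {}" using roles_nonempty by (simp add: advance_def)
  ultimately have "Max (height L ` set (advance k L U S)) < Max (height L ` set U)" by auto
  \<comment> \<open>One unit of the leading digit pays for the return to the full list of pieces,
    whose length is one less than the base.\<close>
  then have "Suc (Max (height L ` set (advance k L U S))) * Suc (length (pieces k))
      \<le> Max (height L ` set U) * Suc (length (pieces k))" by (intro mult_le_mono1) simp
  then show ?thesis unfolding K rank_def by simp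
qed

abbreviation "circ \<equiv> protocol_circuit k L"
abbreviation "gate_no K \<equiv> position K (keys k L)"

lemma gates_pos:
  assumes "(U, S) \<in> set (keys k L)"
  shows "gate_no (U, S) < length (gates circ)" "gates circ ! gate_no (U, S) = key_gate k L U S"
  using position[OF assms] by (auto simp: protocol_circuit_def)

lemma wires_key:
  assumes "(u, v) \<in> wires circ"
  obtains U S K where "u < length (keys k L)" "keys k L ! u = (U, S)" "token k U [0..<k] \<in> inner L"
    "K \<in> set (succs k L U S)" "v = gate_no K" "K \<in> set (keys k L)"
proof -
  obtain us where us: "u < length (keys k L)" "gates circ ! u = Thr us" "v \<in> set us"
    using assms by (auto simp: wires_def protocol_circuit_def)
  obtain U S where US: "keys k L ! u = (U, S)" by fastforce
  then have mem: "(U, S) \<in> set (keys k L)" using us(1) nth_mem by metis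
  have "key_gate k L U S = Thr us" using us US by (simp add: protocol_circuit_def)
  then have "token k U [0..<k] \<in> inner L" "us = map gate_no (succs k L U S)"
    by (auto simp: key_gate_def Let_def split: if_splits)
  then show ?thesis using that us US succs_key[OF mem] by auto
qed

lemma wires_rank:
  assumes "(u, v) \<in> wires circ"
  shows "rank k L (keys k L ! v) < rank k L (keys k L ! u)"
proof -
  obtain U S K where K: "u < length (keys k L)" "keys k L ! u = (U, S)" "token k U [0..<k] \<in> inner L"
    "K \<in> set (succs k L U S)" "v = gate_no K" "K \<in> set (keys k L)"
    by (rule wires_key[OF assms])
  have "(U, S) \<in> set (keys k L)" using K(1,2) nth_mem by metis
  from succs_rank[OF this K(4,3)] show ?thesis using K by (simp add: nth_position)
qed

lemma thr_protocol_circuit: "thr_circuit k n circ"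
  unfolding thr_circuit_def
proof (intro conjI ballI)
  show "out_node circ < length (gates circ)"
    using position_less[OF start_key] by (simp add: protocol_circuit_def)
  show "acyclic (wires circ)"
    by (rule acyclicI_order[where f = "\<lambda>u. rank k L (keys k L ! u)"]) (rule wires_rank)
  fix g assume "g \<in> set (gates circ)"
  then obtain U S where US: "(U, S) \<in> set (keys k L)" "g = key_gate k L U S"
    by (auto simp: protocol_circuit_def)
  let ?u = "token k U [0..<k]"
  have "?u \<in> set U" using US(1) by (intro token_in id_role) (simp add: set_keys)
  then have u: "?u < num_nodes L" using US(1) by (auto simp: set_keys)
  show "case g of Lit j s \<Rightarrow> j < n | Thr us \<Rightarrow> length us = k + 1 \<and> set us \<subseteq> {..<length (gates circ)}"
  proof (cases "?u \<in> inner L")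
    case True
    have "gate_no K < length (gates circ)" if "K \<in> set (succs k L U S)" for K
      using position_less[OF succs_key[OF US(1) that]] by (simp add: protocol_circuit_def)
    moreover have "length (succs k L U S) = k + 1" by (simp add: succs_def)
    ultimately show ?thesis using True US(2) by (auto simp: key_gate_def Let_def)
  next
    case False
    then have "fst (leaf L ?u) < n" using u dag_protocolD(7)[OF dag] by (auto simp: terminals_def)
    then show ?thesis using False US(2) by (simp add: key_gate_def Let_def)
  qed
qed

lemma relpow_rank: "(u, v) \<in> wires circ ^^ d \<Longrightarrow> rank k L (keys k L ! v) + d \<le> rank k L (keys k L ! u)"
proof (induction d arbitrary: v)
  case (Suc d)
  then obtain w where "(u, w) \<in> wires circ ^^ d" "(w, v) \<in> wires circ" by auto
  then show ?case using Suc.IH[of w] wires_rank[of w v] by simp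
qed simp

text \<open>The depth is a maximum over paths to input nodes; this provides a path, so that the
  maximum is taken over a nonempty set.\<close>

lemma reaches_input:
  assumes "K \<in> set (keys k L)"
  shows "\<exists>d. \<exists>u\<in>input_nodes circ. (gate_no K, u) \<in> wires circ ^^ d"
  using assms
proof (induction "rank k L K" arbitrary: K rule: less_induct)
  case less
  obtain U S where K: "K = (U, S)" by fastforce
  note mem = less.prems[unfolded K]
  show ?case
  proof (cases "token k U [0..<k] \<in> inner L")
    case True
    have "succs k L U S \<noteq> []" by (auto simp: succs_def)
    then obtain K' where K': "K' \<in> set (succs k L U S)" using hd_in_set by blast
    obtain d u where d: "u \<in> input_nodes circ" "(gate_no K', u) \<in> wires circ ^^ d"
      using less.hyps[of K'] succs_rank[OF mem K' True] succs_key[OF mem K'] K by blast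
    have "(gate_no K, gate_no K') \<in> wires circ"
      using gates_pos[OF mem] K' True K by (auto simp: wires_def key_gate_def)
    then have "(gate_no K, u) \<in> wires circ ^^ Suc d" using d(2) by (rule relpow_Suc_I2)
    then show ?thesis using d(1) by blast
  next
    case False
    then have "gate_no K \<in> input_nodes circ"
      using gates_pos[OF mem] K by (simp add: input_nodes_def key_gate_def Let_def)
    moreover have "(gate_no K, gate_no K) \<in> wires circ ^^ 0" by simp
    ultimately show ?thesis by blast
  qed
qed

text \<open>With \<open>M\<close> pieces and start height \<open>H\<close>, the output has rank
  \<open>M + 1\<close> times \<open>H\<close>, plus \<open>M\<close>. If the start is inner,
  \<open>H\<close> is positive and the last summand is at most \<open>M\<close> times
  \<open>H\<close>; if it is terminal, the output is itself a literal and the depth is 0.\<close>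

lemma depth_protocol_circuit:
  "circuit_depth circ \<le> (2 * length (pieces k) + 1) * height L (start L)"
proof -
  let ?K = "(replicate (length (roles k)) (start L), pieces k)"
  let ?M = "length (pieces k)"
  let ?D = "{d. \<exists>u\<in>input_nodes circ. (out_node circ, u) \<in> wires circ ^^ d}"
  have out: "out_node circ = gate_no ?K" by (simp add: protocol_circuit_def)
  have key: "keys k L ! gate_no ?K = ?K" by (rule nth_position[OF start_key])
  have "set (replicate (length (roles k)) (start L)) = {start L}"
    using roles_nonempty by simp
  then have rank: "rank k L ?K = height L (start L) * Suc ?M + ?M" by (simp add: rank_def)
  have tok: "token k (replicate (length (roles k)) (start L)) [0..<k] = start L"
    using position_less[OF id_role] by (simp add: token_def)
  have bound: "d \<le> (2 * ?M + 1) * height L (start L)" if "d \<in> ?D" for d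
  proof (cases "start L \<in> inner L")
    case True
    then have "0 < height L (start L)" using height_child[OF dag True, of False] by simp
    then have "?M * 1 \<le> ?M * height L (start L)" by (intro mult_le_mono2) simp
    moreover have "d \<le> rank k L ?K" using that relpow_rank key unfolding out by fastforce
    ultimately have "d \<le> height L (start L) * Suc ?M + ?M * height L (start L)"
      unfolding rank by linarith
    then show ?thesis by (simp add: algebra_simps)
  next
    case False
    have "(gate_no ?K, v) \<notin> wires circ" for v
    proof
      assume "(gate_no ?K, v) \<in> wires circ"
      then show False by (rule wires_key) (use key tok False in auto)
    qed
    then have "(gate_no ?K, v) \<notin> wires circ ^^ Suc d'" for d' v by (blast elim: relpow_E2)
    then have "d = 0" using that unfolding out by (cases d) blast+
    then show ?thesis by simp
  qed
  then have "finite ?D" by (meson finite_nat_set_iff_bounded_le)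
  moreover have "?D \<noteq> {}" using reaches_input[OF start_key] unfolding out by blast
  ultimately have "Max ?D \<le> (2 * ?M + 1) * height L (start L)" by (intro Max.boundedI bound)
  then show ?thesis unfolding circuit_depth_def .
qed

text \<open>The factor and the exponent depend on \<open>k\<close> alone, so this is polynomial in
  the number of nodes.\<close>

lemma size_protocol_circuit:
  "circuit_size circ = length (stages k) * num_nodes L ^ length (roles k)"
  by (simp add: circuit_size_def protocol_circuit_def keys_def states_def length_n_lists)

end

section \<open>Light forms and compatibility along paths\<close>

lemma light_simps [simp]:
  "num_nodes (light \<pi>) = num_nodes \<pi>" "start (light \<pi>) = start \<pi>" "inner (light \<pi>) = inner \<pi>"
  "child (light \<pi>) = child \<pi>" "part (light \<pi>) = part \<pi>" "leaf (light \<pi>) = leaf \<pi>"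
  by (simp_all add: light_form.truncate_def)

lemma path_light: "path (light \<pi>) u es v = path \<pi> u es v"
  by (induction es arbitrary: u) auto

lemma dag_light: "dag_protocol k n (light \<pi>) = dag_protocol k n \<pi>"
  by (simp add: dag_protocol_def path_light terminals_def)

lemma height_start: "height (light \<pi>) (start \<pi>) = protocol_depth \<pi>"
  by (simp add: height_def protocol_depth_def path_light)

lemma path_snoc: "path L u es v \<Longrightarrow> v \<in> inner L \<Longrightarrow> path L u (es @ [(v, b)]) (child L v b)"
  by (induction es arbitrary: u) auto

lemma node_compatible_child:
  assumes "node_compatible \<pi> i x v" "v \<in> inner \<pi>" "v \<in> part \<pi> i \<Longrightarrow> b = speak \<pi> i v x"
  shows "node_compatible \<pi> i x (child \<pi> v b)"
proof -
  obtain es where "path \<pi> (start \<pi>) es v" "path_compatible \<pi> i x es"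
    using assms(1) unfolding node_compatible_def by blast
  then have "path \<pi> (start \<pi>) (es @ [(v, b)]) (child \<pi> v b)" "path_compatible \<pi> i x (es @ [(v, b)])"
    using path_snoc[OF _ assms(2)] assms(3) by (auto simp: path_compatible_def edge_compatible_def)
  then show ?thesis unfolding node_compatible_def by blast
qed

section \<open>Correctness: zeros of the function in classes and pieces\<close>

definition plays :: "nat \<Rightarrow> protocol \<Rightarrow> bool list \<Rightarrow> nat list \<Rightarrow> nat \<Rightarrow> bool" where
  "plays k \<pi> x U r \<longleftrightarrow>
     (\<forall>\<phi>\<in>set (roles k). \<forall>i<k. \<phi> ! i = r \<longrightarrow> node_compatible \<pi> i x (token k U \<phi>))"

text \<open>Only role assignments in which the owner of the token's node plays class
  \<open>r\<close> constrain \<open>\<beta>\<close>. The other bits are free, so pieces may overlap;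
  what matters is that they cover.\<close>

definition answers :: "nat \<Rightarrow> protocol \<Rightarrow> bool list \<Rightarrow> nat list \<Rightarrow> nat \<Rightarrow> bool list \<Rightarrow> bool" where
  "answers k \<pi> x U r \<beta> \<longleftrightarrow>
     (\<forall>\<phi>\<in>set (roles k). token k U \<phi> \<in> inner \<pi> \<longrightarrow> \<phi> ! owner k (light \<pi>) (token k U \<phi>) = r \<longrightarrow>
        \<beta> ! position \<phi> (roles k) = speak \<pi> (owner k (light \<pi>) (token k U \<phi>)) (token k U \<phi>) x)"

definition in_piece :: "nat \<Rightarrow> protocol \<Rightarrow> bool list \<Rightarrow> nat list \<Rightarrow> nat \<times> bool list \<Rightarrow> bool" where
  "in_piece k \<pi> x U p \<longleftrightarrow> plays k \<pi> x U (fst p) \<and> answers k \<pi> x U (fst p) (snd p)"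

text \<open>\<open>pieces k\<close> contains every bit vector, among them the one that
  \<open>x\<close> produces by speaking for the owner at each token.\<close>

lemma plays_in_piece:
  assumes "plays k \<pi> x U r" "r < k"
  shows "\<exists>p\<in>set (pieces k). in_piece k \<pi> x U p"
proof -
  let ?\<beta> = "map (\<lambda>\<phi>. speak \<pi> (owner k (light \<pi>) (token k U \<phi>)) (token k U \<phi>) x) (roles k)"
  have "(r, ?\<beta>) \<in> set (pieces k)" using assms(2) by (simp add: set_pieces)
  moreover have "in_piece k \<pi> x U (r, ?\<beta>)"
    using assms(1) by (simp add: in_piece_def answers_def position)
  ultimately show ?thesis by blast
qed

text \<open>If \<open>\<phi>\<close> gives class \<open>r\<close> to party \<open>i\<close>, then
  the composed role assignment gives \<open>i\<close> the old class of \<open>S ! r\<close>, so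
  \<open>x\<close> is compatible with the old token. If \<open>i\<close> owns that node, the token
  follows the bit stored in \<open>S ! r\<close>, which is the bit of \<open>x\<close>; if not,
  every edge is compatible for \<open>i\<close>.\<close>

lemma plays_advance:
  assumes "k \<ge> 2" and dag: "dag_protocol k n (light \<pi>)"
    and key: "(U, S) \<in> set (keys k (light \<pi>))"
    and "r < k" and piece: "in_piece k \<pi> x U (S ! r)"
  shows "plays k \<pi> x (advance k (light \<pi>) U S) r"
  unfolding plays_def
proof (intro ballI allI impI)
  fix \<phi> i assume \<phi>: "\<phi> \<in> set (roles k)" and i: "i < k" "\<phi> ! i = r"
  let ?\<psi> = "map (\<lambda>j. fst (S ! j)) \<phi>"
  let ?u = "token k U ?\<psi>"
  have \<psi>: "?\<psi> \<in> set (roles k)" using key by (intro comp_roles \<phi>) (simp add: set_keys)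
  have len: "length \<phi> = k" using \<phi> by (simp add: set_roles)
  have \<psi>i: "?\<psi> ! i = fst (S ! r)" using i len by simp
  have u: "node_compatible \<pi> i x ?u"
    using piece \<psi> i(1) \<psi>i unfolding in_piece_def plays_def by blast
  have adv: "token k (advance k (light \<pi>) U S) \<phi> =
    (if ?u \<in> inner \<pi> then child \<pi> ?u (snd (S ! (\<phi> ! owner k (light \<pi>) ?u)) ! position ?\<psi> (roles k)) else ?u)"
    unfolding advance_def by (subst token_map[OF \<phi>]) (simp add: Let_def)
  show "node_compatible \<pi> i x (token k (advance k (light \<pi>) U S) \<phi>)"
  proof (cases "?u \<in> inner \<pi>")
    case True
    have "node_compatible \<pi> i x (child \<pi> ?u (snd (S ! (\<phi> ! owner k (light \<pi>) ?u)) ! position ?\<psi> (roles k)))"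
    proof (rule node_compatible_child[OF u True])
      assume "?u \<in> part \<pi> i"
      then have own: "owner k (light \<pi>) ?u = i"
        using owner_iff[OF assms(1) dag _ i(1), of ?u] True by simp
      then show "snd (S ! (\<phi> ! owner k (light \<pi>) ?u)) ! position ?\<psi> (roles k) = speak \<pi> i ?u x"
        using piece \<psi> True \<psi>i i(2) unfolding in_piece_def answers_def by metis
    qed
    then show ?thesis using adv True by simp
  qed (use adv u in simp)
qed

lemma plays_start: "plays k \<pi> x (replicate (length (roles k)) (start \<pi>)) r"
proof -
  have "path \<pi> (start \<pi>) [] (start \<pi>)" "path_compatible \<pi> i x []" for i
    by (simp_all add: path_compatible_def)
  then have "node_compatible \<pi> i x (start \<pi>)" for i unfolding node_compatible_def by blast
  then show ?thesis by (simp add: plays_def token_def position)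
qed

text \<open>A threshold-2 gate tolerates one uncontrolled input, here the one at position
  \<open>j\<close>.\<close>

lemma length_filter_le_1:
  assumes "\<And>i. i < length bs \<Longrightarrow> bs ! i \<Longrightarrow> i = j"
  shows "\<not> 2 \<le> length (filter id bs)"
proof -
  have "{i. i < length bs \<and> id (bs ! i)} \<subseteq> {j}" using assms by auto
  then have "card {i. i < length bs \<and> id (bs ! i)} \<le> card {j}" by (intro card_mono) auto
  then show ?thesis by (simp add: length_filter_conv_card)
qed

text \<open>The invariant of the circuit: a gate vanishes on each zero that lies in one of its
  remaining pieces. As \<open>node_value\<close> is a relation, the existence of a value is proved
  in the same induction, over the rank.\<close>

lemma key_value:
  assumes k: "k \<ge> 2" and dag: "dag_protocol k n (light \<pi>)"
    and strong: "strongly_computes k n f \<pi>" and x: "x \<in> zeros n f"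
    and "(U, S) \<in> set (keys k (light \<pi>))"
  shows "\<exists>b. node_value (protocol_circuit k (light \<pi>)) x (position (U, S) (keys k (light \<pi>))) b \<and>
           ((\<exists>p\<in>set S. in_piece k \<pi> x U p) \<longrightarrow> \<not> b)"
  using assms(5)
proof (induction "rank k (light \<pi>) (U, S)" arbitrary: U S rule: less_induct)
  case less
  let ?L = "light \<pi>"
  let ?C = "protocol_circuit k ?L"
  let ?pos = "\<lambda>K. position K (keys k ?L)"
  let ?good = "\<lambda>K. \<exists>p\<in>set (snd K). in_piece k \<pi> x (fst K) p"
  let ?u = "token k U [0..<k]"
  note key = less.prems
  note gate = gates_pos[OF k dag key]
  have U: "length U = length (roles k)" and S: "S \<in> set (stages k)" using key by (auto simp: set_keys)
  show ?case
  proof (cases "?u \<in> inner \<pi>")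
    case True
    let ?Ks = "succs k ?L U S"
    have "\<exists>b. node_value ?C x (?pos K) b \<and> (?good K \<longrightarrow> \<not> b)" if "K \<in> set ?Ks" for K
      using less.hyps[of "fst K" "snd K"] succs_rank[OF k dag key that] succs_key[OF k dag key that] True
      by simp
    then obtain B where B: "\<And>K. K \<in> set ?Ks \<Longrightarrow> node_value ?C x (?pos K) (B K)"
      "\<And>K. K \<in> set ?Ks \<Longrightarrow> ?good K \<Longrightarrow> \<not> B K"
      by metis
    have "gates ?C ! ?pos (U, S) = Thr (map ?pos ?Ks)"
      using gate(2) True by (simp add: key_gate_def)
    moreover have "list_all2 (node_value ?C x) (map ?pos ?Ks) (map B ?Ks)"
      using B(1) by (simp add: list_all2_conv_all_nth)
    ultimately have val: "node_value ?C x (?pos (U, S)) (length (filter id (map B ?Ks)) \<ge> 2)"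
      by (intro node_value.thr gate(1))
    have "\<not> 2 \<le> length (filter id (map B ?Ks))" if p: "p \<in> set S" "in_piece k \<pi> x U p" for p
    proof (cases "length S > k")
      case True
      obtain j where j: "j < length S" "S ! j = p" using p(1) by (auto simp: in_set_conv_nth)
      show ?thesis
      \<comment> \<open>Omitting a position other than \<open>j\<close> keeps \<open>p\<close> in
        the list, which makes that input false; only the input that omits position \<open>j\<close>
        may be true.\<close>
      proof (rule length_filter_le_1)
        fix i assume i: "i < length (map B ?Ks)" "map B ?Ks ! i"
        then have i': "i < Suc k" using True by (simp add: succs_def)
        then have K: "?Ks ! i = (U, take i S @ drop (Suc i) S)"
          using True by (simp add: succs_def del: upt_Suc)
        have "?Ks ! i \<in> set ?Ks" using i(1) by simp
        then have "\<not> ?good (?Ks ! i)" using B(2) i by force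
        then have "p \<notin> set (take i S @ drop (Suc i) S)" using K p(2) by auto
        moreover have "p \<in> set (take i S @ drop (Suc i) S)" if "i \<noteq> j"
        proof (cases "j < i")
          case True
          then show ?thesis using j by (auto simp: in_set_conv_nth)
        next
          case False
          then have "drop (Suc i) S ! (j - Suc i) = p" "j - Suc i < length (drop (Suc i) S)"
            using that j by auto
          then show ?thesis by (metis Un_iff nth_mem set_append)
        qed
        ultimately show "i = j" by blast
      qed
    next
      case False
      then have len: "length S = k" using S by (simp add: set_stages)
      obtain r where r: "r < k" "S ! r = p" using p(1) len by (auto simp: in_set_conv_nth)
      \<comment> \<open>With \<open>k\<close> pieces left, the position \<open>r\<close> of
        \<open>p\<close> becomes the class of \<open>x\<close>. Some piece of the next round then
        holds \<open>x\<close>, and all inputs of the gate, being the same node, are false.\<close>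
      have "plays k \<pi> x (advance k ?L U S) r"
        using plays_advance[OF k dag key r(1)] r(2) p(2) by simp
      then have "?good (advance k ?L U S, pieces k)"
        using plays_in_piece r(1) by simp
      moreover have "K = (advance k ?L U S, pieces k)" if "K \<in> set ?Ks" for K
        using that False by (auto simp: succs_def split: if_splits)
      ultimately have "\<not> B K" if "K \<in> set ?Ks" for K
        using B(2)[OF that] that by metis
      then have "filter id (map B ?Ks) = []" by (auto simp: filter_empty_conv)
      then show ?thesis by simp
    qed
    then show ?thesis using val by blast
  next
    case False
    have "gates ?C ! ?pos (U, S) = Lit (fst (leaf \<pi> ?u)) (\<not> snd (leaf \<pi> ?u))"
      using gate(2) False by (simp add: key_gate_def Let_def)
    then have val: "node_value ?C x (?pos (U, S)) (x ! fst (leaf \<pi> ?u) = (\<not> snd (leaf \<pi> ?u)))"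
      by (intro node_value.lit gate(1))
    have "?u \<in> set U" by (intro token_in U id_role[OF k dag])
    then have t: "?u \<in> terminals \<pi>" using False key by (auto simp: set_keys terminals_def)
    have "x ! fst (leaf \<pi> ?u) = snd (leaf \<pi> ?u)" if p: "p \<in> set S" "in_piece k \<pi> x U p" for p
    proof -
      have r: "fst p < k" using p(1) S by (auto simp: set_stages set_pieces)
      \<comment> \<open>Under the identity, party \<open>fst p\<close> plays class
        \<open>fst p\<close>, so strong computation applies to this party at the terminal.\<close>
      moreover have "[0..<k] ! fst p = fst p" using r by simp
      ultimately have "node_compatible \<pi> (fst p) x ?u"
        using p(2) id_role[OF k dag] unfolding in_piece_def plays_def by blast
      then show ?thesis using strong t x r unfolding strongly_computes_def by blast
    qed
    then show ?thesis using val by blast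
  qed
qed

lemma circuit_le_protocol_circuit:
  assumes k: "k \<ge> 2" and dag: "dag_protocol k n (light \<pi>)" and "strongly_computes k n f \<pi>"
  shows "circuit_le n (protocol_circuit k (light \<pi>)) f"
  unfolding circuit_le_def
proof
  fix x assume "x \<in> zeros n f"
  let ?U = "replicate (length (roles k)) (start \<pi>)"
  have key: "(?U, pieces k) \<in> set (keys k (light \<pi>))" using start_key[OF k dag] by simp
  \<comment> \<open>At the start every input belongs to every class, so class 0 will do.\<close>
  have "\<exists>p\<in>set (pieces k). in_piece k \<pi> x ?U p"
    by (rule plays_in_piece[OF plays_start, of 0]) (use k in simp)
  then obtain b where "node_value (protocol_circuit k (light \<pi>)) x (position (?U, pieces k) (keys k (light \<pi>))) b" "\<not> b"
    using key_value[OF k dag assms(3) \<open>x \<in> zeros n f\<close> key] by blast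
  then show "node_value (protocol_circuit k (light \<pi>)) x (out_node (protocol_circuit k (light \<pi>))) False"
    by (simp add: protocol_circuit_def)
qed

section \<open>The algorithm\<close>

lemma FP_if_const: "FP f \<Longrightarrow> FP g \<Longrightarrow> FP (\<lambda>d. if b then f d else g d)"
  by (cases b) auto

text \<open>The list \<open>xs\<close> is fixed before the program is written, so the code for its
  entries is simply unrolled. Every enumeration that depends on \<open>k\<close> alone is handled in
  this way.\<close>

lemma FP_enc_list:
  assumes "\<And>x. x \<in> set xs \<Longrightarrow> FP (F x)"
  shows "FP (\<lambda>d. enc_list (map (\<lambda>x. F x d) xs))"
  using assms by (induction xs) (auto intro: FP_const FP_Dot)

lemmas FP_basic = FP_const FP_id FP_hd FP_tl FP_Dot FP_eq FP_if FP_if_const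

section \<open>Numbers, lists and tables as trees\<close>

fun inc :: "tree \<Rightarrow> tree" where
  "inc Atom = Dot (Dot Atom Atom) Atom"
| "inc (Dot b t) = (if b = Atom then Dot (Dot Atom Atom) t else Dot Atom (inc t))"

lemma FP_inc: "FP f \<Longrightarrow> FP (\<lambda>d. inc (f d))"
  by (rule FP_rec[where F = "\<lambda>e. inc" and a = "\<lambda>e. Dot (Dot Atom Atom) Atom"
        and f = "\<lambda>d. d" and P = "\<lambda>d. tsize d + 8"
        and G = "\<lambda>e x y r. if x = Atom then Dot (Dot Atom Atom) y else Dot Atom r"])
    (auto intro!: FP_basic poly_bounded_intros)

text \<open>The extreme case is a new leading digit, where \<open>Atom\<close> of size 1 becomes a
  tree of size 5. The constant increment is what \<open>FP_rec\<close> asks for when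
  \<open>inc\<close> serves as its step.\<close>

lemma tsize_inc: "tsize (inc t) \<le> tsize t + 4"
proof (induction t)
  case (Dot b t)
  then show ?case by (cases b) (auto simp: trans_le_add2)
qed simp

lemma inc_enc_nat: "inc (enc_nat m) = enc_nat (Suc m)"
proof (induction m rule: less_induct)
  case (less m)
  consider "m = 0" | q where "m = 2 * q" "m > 0" | q where "m = 2 * q + 1" by (metis oddE evenE gr0I)
  then show ?case
  proof cases
    case 1
    then show ?thesis by (simp add: enc_nat.simps)
  next
    case 2
    then show ?thesis by (subst (1 2) enc_nat.simps) simp
  next
    case 3
    then have "Suc m = 2 * Suc q" by simp
    then have "enc_nat (Suc m) = Dot Atom (enc_nat (Suc q))"
      by (subst enc_nat.simps) simp
    moreover have "enc_nat m = Dot (Dot Atom Atom) (enc_nat q)"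
      using 3 by (subst enc_nat.simps) simp
    ultimately show ?thesis using less[of q] 3 by simp
  qed
qed

lemma enc_nat_eq_Atom: "enc_nat m = Atom \<longleftrightarrow> m = 0"
  by (subst enc_nat.simps) simp

lemma enc_bool_eq_iff: "enc_bool a = enc_bool b \<longleftrightarrow> a = b"
  by (cases a; cases b) auto

text \<open>Parity and half determine a number. Injectivity lets equality of trees stand for
  equality of numbers in table lookups and searches.\<close>

lemma enc_nat_eq_iff: "enc_nat a = enc_nat b \<longleftrightarrow> a = b"
proof (induction a arbitrary: b rule: less_induct)
  case (less a)
  show ?case
  proof (cases "a = 0 \<or> b = 0")
    case True
    then show ?thesis using enc_nat_eq_Atom[of a] enc_nat_eq_Atom[of b] by (auto simp: enc_nat.simps[of 0])
  next
    case False
    then have "enc_nat a = enc_nat b \<longleftrightarrow> odd a = odd b \<and> enc_nat (a div 2) = enc_nat (b div 2)"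
      by (simp add: enc_nat.simps[of a] enc_nat.simps[of b] enc_bool_eq_iff)
    also have "\<dots> \<longleftrightarrow> odd a = odd b \<and> a div 2 = b div 2"
      using less[of "a div 2" "b div 2"] False by simp
    also have "\<dots> \<longleftrightarrow> a = b" by (metis bit_eq_rec)
    finally show ?thesis .
  qed
qed

lemma enc_list_map_eq_iff:
  assumes "\<And>x y. e x = e y \<longleftrightarrow> x = y"
  shows "enc_list (map e xs) = enc_list (map e ys) \<longleftrightarrow> xs = ys"
proof (induction xs arbitrary: ys)
  case Nil
  show ?case by (cases ys) auto
next
  case (Cons x xs)
  then show ?case by (cases ys) (auto simp: assms)
qed

fun len :: "tree \<Rightarrow> tree" where
  "len Atom = Atom"
| "len (Dot x y) = inc (len y)"

lemma FP_len: "FP f \<Longrightarrow> FP (\<lambda>d. len (f d))"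
  by (rule FP_rec[where F = "\<lambda>e. len" and a = "\<lambda>e. Atom" and f = "\<lambda>d. d" and P = "\<lambda>d. 4" and G = "\<lambda>e x y r. inc r"])
    (auto intro!: FP_basic FP_inc poly_bounded_intros tsize_inc)

lemma len_enc_list: "len (enc_list xs) = enc_nat (length xs)"
  by (induction xs) (auto simp: inc_enc_nat enc_nat.simps[of 0])

fun app :: "tree \<Rightarrow> tree \<Rightarrow> tree" where
  "app Atom e = e"
| "app (Dot x y) e = Dot x (app y e)"

lemma FP_app: "FP f \<Longrightarrow> FP g \<Longrightarrow> FP (\<lambda>d. app (f d) (g d))"
  by (rule FP_rec[where F = "\<lambda>e t. app t e" and a = "\<lambda>e. e" and P = "tsize" and G = "\<lambda>e x y r. Dot x r"])
    (auto intro!: FP_basic poly_bounded_intros)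

lemma tsize_app: "tsize (app t e) \<le> tsize e + tsize t"
  by (induction t) auto

lemma app_enc_list: "app (enc_list xs) (enc_list ys) = enc_list (xs @ ys)"
  by (induction xs) auto

fun trev :: "tree \<Rightarrow> tree" where
  "trev Atom = Atom"
| "trev (Dot x y) = app (trev y) (Dot x Atom)"

lemma FP_trev: "FP f \<Longrightarrow> FP (\<lambda>d. trev (f d))"
proof (rule FP_rec[where F = "\<lambda>e. trev" and a = "\<lambda>e. Atom" and f = "\<lambda>d. d" and P = tsize
      and G = "\<lambda>e x y r. app r (Dot x Atom)"])
  show "tsize (app r (Dot x Atom)) \<le> tsize r + tsize (Dot e (Dot x y))" for r x e y
    using tsize_app[of r "Dot x Atom"] by simp
qed (auto intro!: FP_basic FP_app poly_bounded_intros)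

lemma trev_enc_list: "trev (enc_list xs) = enc_list (rev xs)"
proof (induction xs)
  case (Cons x xs)
  then show ?case using app_enc_list[of "rev xs" "[x]"] by simp
qed simp

text \<open>\<open>len y\<close> is the index of \<open>x\<close> counted from the end, hence the table is built from the
  reversed list of nodes.\<close>

fun table :: "tree \<Rightarrow> tree" where
  "table Atom = Atom"
| "table (Dot x y) = Dot (Dot (len y) x) (table y)"

lemma FP_table: "FP f \<Longrightarrow> FP (\<lambda>d. table (f d))"
proof (rule FP_rec[where F = "\<lambda>e. table" and a = "\<lambda>e. Atom" and f = "\<lambda>d. d"
      and P = "\<lambda>d. tsize d + tsize (len (tl_tree (tl_tree d)))"
      and G = "\<lambda>e x y r. Dot (Dot (len y) x) r"])
  show "poly_bounded (\<lambda>d. tsize d + tsize (len (tl_tree (tl_tree d))))"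
    by (intro poly_bounded_intros FP_tsize FP_basic FP_len)
qed (auto intro!: FP_basic FP_len)

lemma table_enc_list:
  "table (enc_list xs) = enc_list (map (\<lambda>i. Dot (enc_nat i) (rev xs ! i)) (rev [0..<length xs]))"
proof (induction xs)
  case (Cons x xs)
  have upt: "rev [0..<length (x # xs)] = length xs # rev [0..<length xs]" by simp
  have tail: "map (\<lambda>i. Dot (enc_nat i) (rev (x # xs) ! i)) (rev [0..<length xs])
      = map (\<lambda>i. Dot (enc_nat i) (rev xs ! i)) (rev [0..<length xs])"
    by (auto simp: nth_append)
  have "rev (x # xs) ! length xs = x" by (simp add: nth_append)
  then show ?case
    by (simp only: enc_list.simps table.simps Cons len_enc_list upt list.map tail)
qed simp

fun look :: "tree \<Rightarrow> tree \<Rightarrow> tree" where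
  "look v Atom = Atom"
| "look v (Dot p y) = (if hd_tree p = v then tl_tree p else look v y)"

lemma FP_look: "FP f \<Longrightarrow> FP g \<Longrightarrow> FP (\<lambda>d. look (f d) (g d))"
proof (rule FP_rec[where F = look and a = "\<lambda>e. Atom" and P = "tsize"
      and G = "\<lambda>e x y r. if hd_tree x = e then tl_tree x else r"])
  show "tsize (if hd_tree x = e then tl_tree x else r) \<le> tsize r + tsize (Dot e (Dot x y))" for x e r y
    using tsize_tl_le[of x] by simp
qed (auto intro!: FP_basic poly_bounded_intros)

lemma look_enc_list:
  "v \<in> set is \<Longrightarrow> look (enc_nat v) (enc_list (map (\<lambda>i. Dot (enc_nat i) (g i)) is)) = g v"
  by (induction "is") (auto simp: enc_nat_eq_iff)

fun find_pos :: "tree \<Rightarrow> tree \<Rightarrow> tree" where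
  "find_pos z Atom = Atom"
| "find_pos z (Dot x y) = (if x = z then Atom else inc (find_pos z y))"

lemma FP_find_pos: "FP f \<Longrightarrow> FP g \<Longrightarrow> FP (\<lambda>d. find_pos (f d) (g d))"
  by (rule FP_rec[where F = find_pos and a = "\<lambda>e. Atom" and P = "\<lambda>d. 4"
        and G = "\<lambda>e x y r. if x = e then Atom else inc r"])
    (auto intro!: FP_basic FP_inc poly_bounded_intros tsize_inc)

lemma find_pos_enc_list:
  assumes "\<And>x y. e x = e y \<longleftrightarrow> x = y"
  shows "find_pos (e x) (enc_list (map e xs)) = enc_nat (position x xs)"
  by (induction xs) (auto simp: assms inc_enc_nat enc_nat.simps[of 0])

text \<open>The parameter \<open>e\<close> reaches \<open>h\<close> paired with the entry, since
  functions in \<open>FP\<close> take one argument. Nested uses form products of lists.\<close>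

fun concat_map :: "(tree \<Rightarrow> tree) \<Rightarrow> tree \<Rightarrow> tree \<Rightarrow> tree" where
  "concat_map h e Atom = Atom"
| "concat_map h e (Dot x y) = app (h (Dot e x)) (concat_map h e y)"

lemma FP_concat_map:
  assumes "FP h" "FP f" "FP g"
  shows "FP (\<lambda>d. concat_map h (f d) (g d))"
proof (rule FP_rec[where F = "concat_map h" and a = "\<lambda>e. Atom"
      and P = "\<lambda>d. tsize (h (Dot (hd_tree d) (hd_tree (tl_tree d))))"
      and G = "\<lambda>e x y r. app (h (Dot e x)) r"])
  have "FP (\<lambda>d. h (Dot (hd_tree d) (hd_tree (tl_tree d))))"
    by (rule FP_comp[OF assms(1)]) (intro FP_basic)
  then show "poly_bounded (\<lambda>d. tsize (h (Dot (hd_tree d) (hd_tree (tl_tree d)))))" by (rule FP_tsize)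
  have "FP (\<lambda>p. h (Dot (hd_tree p) (hd_tree (hd_tree (tl_tree p)))))"
    by (rule FP_comp[OF assms(1)]) (intro FP_basic)
  then show "FP (\<lambda>p. app (h (Dot (hd_tree p) (hd_tree (hd_tree (tl_tree p))))) (tl_tree (tl_tree p)))"
    by (intro FP_basic FP_app)
  show "tsize (app (h (Dot e x)) r) \<le> tsize r + tsize (h (Dot (hd_tree (Dot e (Dot x y)))
      (hd_tree (tl_tree (Dot e (Dot x y))))))" for e x y r
    using tsize_app[of "h (Dot e x)" r] by simp
qed (use assms in \<open>auto intro!: FP_basic\<close>)

lemma concat_map_enc_list:
  assumes "\<And>x. x \<in> set xs \<Longrightarrow> h (Dot e (en x)) = enc_list (H x)"
  shows "concat_map h e (enc_list (map en xs)) = enc_list (concat (map H xs))"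
  using assms by (induction xs) (auto simp: app_enc_list)

section \<open>Encodings of states, pieces and keys\<close>

definition enc_state :: "nat list \<Rightarrow> tree" where
  "enc_state U = enc_list (map enc_nat U)"

definition enc_piece :: "nat \<times> bool list \<Rightarrow> tree" where
  "enc_piece p = Dot (enc_nat (fst p)) (enc_list (map enc_bool (snd p)))"

definition enc_key :: "nat list \<times> (nat \<times> bool list) list \<Rightarrow> tree" where
  "enc_key K = Dot (enc_state (fst K)) (enc_list (map enc_piece (snd K)))"

lemma enc_state_eq_iff: "enc_state U = enc_state V \<longleftrightarrow> U = V"
  unfolding enc_state_def by (rule enc_list_map_eq_iff) (rule enc_nat_eq_iff)

lemma enc_piece_eq_iff: "enc_piece p = enc_piece q \<longleftrightarrow> p = q"
  by (simp add: enc_piece_def enc_nat_eq_iff enc_list_map_eq_iff[OF enc_bool_eq_iff] prod_eq_iff)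

text \<open>A search among encoded keys thus stops at the position of the key itself.\<close>

lemma enc_key_eq_iff: "enc_key K = enc_key K' \<longleftrightarrow> K = K'"
  by (simp add: enc_key_def enc_state_eq_iff enc_list_map_eq_iff[OF enc_piece_eq_iff] prod_eq_iff)

section \<open>The circuit built from the encoded light form\<close>

definition node_table :: "tree \<Rightarrow> tree" where
  "node_table d = table (trev (tl_tree d))"

text \<open>The names are read off the table and so come in descending order, as in
  \<open>states\<close>.\<close>

definition node_names :: "tree \<Rightarrow> tree" where
  "node_names d = concat_map (\<lambda>p. Dot (hd_tree (tl_tree p)) Atom) Atom (node_table d)"

text \<open>The nesting reproduces the order of \<open>List.n_lists\<close>: in the inner function
  the head of \<open>q\<close> is the shorter tuple and its tail the name to be put in
  front.\<close>

fun tuples :: "nat \<Rightarrow> tree \<Rightarrow> tree" where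
  "tuples 0 d = Dot Atom Atom"
| "tuples (Suc m) d = concat_map
     (\<lambda>p. concat_map (\<lambda>q. Dot (Dot (tl_tree q) (hd_tree q)) Atom) (tl_tree p) (hd_tree p))
     (node_names d) (tuples m d)"

definition key_list :: "nat \<Rightarrow> tree \<Rightarrow> tree" where
  "key_list k d = concat_map
     (\<lambda>p. enc_list (map (\<lambda>S. Dot (tl_tree p) (enc_list (map enc_piece S))) (stages k)))
     Atom (tuples (length (roles k)) d)"

definition token_tree :: "nat \<Rightarrow> tree \<Rightarrow> nat list \<Rightarrow> tree" where
  "token_tree k u \<phi> = hd_tree ((tl_tree ^^ position \<phi> (roles k)) u)"

text \<open>The bits \<open>\<beta>\<close> belong to the program and not to its data, so the owner
  stored in the encoded node \<open>w\<close> is compared with each party in turn.\<close>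

fun reply :: "tree \<Rightarrow> (nat \<Rightarrow> bool) \<Rightarrow> nat list \<Rightarrow> tree" where
  "reply w \<beta> [] = Atom"
| "reply w \<beta> (i # is) = (if hd_tree (tl_tree w) = enc_nat i
     then hd_tree (if \<beta> i then tl_tree (tl_tree (tl_tree w)) else tl_tree (tl_tree w))
     else reply w \<beta> is)"

text \<open>\<open>S\<close> and the role assignments are built into the program; only the table and
  the tokens are data. An encoded node with head \<open>Atom\<close>, the code of
  \<open>False\<close>, is a terminal.\<close>

definition advance_tree :: "nat \<Rightarrow> tree \<Rightarrow> tree \<Rightarrow> (nat \<times> bool list) list \<Rightarrow> tree" where
  "advance_tree k tab u S = enc_list (map (\<lambda>\<phi>.
     if hd_tree (look (token_tree k u (map (\<lambda>j. fst (S ! j)) \<phi>)) tab) = Atom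
     then token_tree k u (map (\<lambda>j. fst (S ! j)) \<phi>)
     else reply (look (token_tree k u (map (\<lambda>j. fst (S ! j)) \<phi>)) tab)
       (\<lambda>i. snd (S ! (\<phi> ! i)) ! position (map (\<lambda>j. fst (S ! j)) \<phi>) (roles k)) [0..<k]) (roles k))"

definition succ_trees :: "nat \<Rightarrow> tree \<Rightarrow> tree \<Rightarrow> (nat \<times> bool list) list \<Rightarrow> tree list" where
  "succ_trees k tab u S =
     (if length S > k then map (\<lambda>i. Dot u (enc_list (map enc_piece (take i S @ drop (Suc i) S)))) [0..<Suc k]
      else replicate (Suc k) (Dot (advance_tree k tab u S) (enc_list (map enc_piece (pieces k)))))"

text \<open>Comparing the encoded bit of a terminal with \<open>Atom\<close> negates it, as required
  for the sign of the literal.\<close>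

definition gate_tree :: "nat \<Rightarrow> tree \<Rightarrow> tree \<Rightarrow> tree \<Rightarrow> (nat \<times> bool list) list \<Rightarrow> tree" where
  "gate_tree k tab ks u S =
     (if hd_tree (look (token_tree k u [0..<k]) tab) = Atom
      then Dot Atom (Dot (hd_tree (tl_tree (look (token_tree k u [0..<k]) tab)))
             (enc_bool (tl_tree (tl_tree (look (token_tree k u [0..<k]) tab)) = Atom)))
      else Dot (Dot Atom Atom) (enc_list (map (\<lambda>z. find_pos z ks) (succ_trees k tab u S))))"

text \<open>States form the outer loop and stages the inner one, so the gates appear in the order of
  \<open>keys\<close>. Table and key list are handed to the loop as its parameter.\<close>

definition circuit_tree :: "nat \<Rightarrow> tree \<Rightarrow> tree" where
  "circuit_tree k d = Dot
     (find_pos (Dot (enc_list (map (\<lambda>\<phi>. hd_tree d) (roles k))) (enc_list (map enc_piece (pieces k)))) (key_list k d))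
     (concat_map (\<lambda>p. enc_list (map (gate_tree k (hd_tree (hd_tree p)) (tl_tree (hd_tree p)) (tl_tree p)) (stages k)))
        (Dot (node_table d) (key_list k d)) (tuples (length (roles k)) d))"

section \<open>Polynomial running time of the construction\<close>

lemma FP_node_table: "FP node_table"
  unfolding node_table_def by (intro FP_table FP_trev FP_basic)

lemma FP_node_names: "FP node_names"
  unfolding node_names_def by (intro FP_concat_map FP_basic FP_node_table)

lemma FP_tuples: "FP (tuples m)"
proof (induction m)
  case (Suc m)
  then show ?case
    unfolding tuples.simps by (intro FP_concat_map FP_basic FP_node_names)
qed (simp add: FP_const)

lemma FP_key_list: "FP (key_list k)"
  unfolding key_list_def by (intro FP_concat_map FP_enc_list FP_basic FP_tuples)

lemma FP_token_tree: "FP f \<Longrightarrow> FP (\<lambda>d. token_tree k (f d) \<phi>)"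
proof -
  assume f: "FP f"
  have "FP (\<lambda>d. (tl_tree ^^ m) (f d))" for m
    by (induction m) (auto intro: FP_basic f)
  then show ?thesis unfolding token_tree_def by (intro FP_hd)
qed

lemma FP_reply: "FP f \<Longrightarrow> FP (\<lambda>d. reply (f d) \<beta> is)"
  by (induction "is") (auto intro!: FP_basic)

lemma FP_advance_tree: "FP f \<Longrightarrow> FP g \<Longrightarrow> FP (\<lambda>d. advance_tree k (f d) (g d) S)"
  unfolding advance_tree_def
  by (intro FP_enc_list FP_if FP_const FP_hd FP_look FP_token_tree FP_reply)

lemma FP_gate_tree:
  assumes "FP f" "FP g" "FP h"
  shows "FP (\<lambda>d. gate_tree k (f d) (g d) (h d) S)"
proof -
  have "FP (\<lambda>d. enc_list (map (\<lambda>z. find_pos z (g d)) (succ_trees k (f d) (h d) S)))"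
  \<comment> \<open>As \<open>S\<close> is fixed, this case is decided when the program is written
    and not when it runs.\<close>
  proof (cases "length S > k")
    case True
    show ?thesis
      unfolding succ_trees_def using True
      by (simp only: if_True map_map comp_def) (intro FP_enc_list FP_find_pos FP_basic assms)
  next
    case False
    \<comment> \<open>The repetition is rewritten as a map over a fixed list, to which
      \<open>FP_enc_list\<close> applies.\<close>
    then have "succ_trees k tab u S = map (\<lambda>_. Dot (advance_tree k tab u S) (enc_list (map enc_piece (pieces k)))) [0..<Suc k]"
      for tab u by (simp only: succ_trees_def if_False map_replicate_const length_upt diff_zero)
    then show ?thesis
      by (simp only: map_map comp_def) (intro FP_enc_list FP_find_pos FP_advance_tree FP_Dot FP_const assms)
  qed
  then show ?thesis
    unfolding gate_tree_def
    by (intro FP_if FP_const FP_hd FP_tl FP_look FP_token_tree FP_Dot FP_eq assms)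
qed

lemma FP_circuit_tree: "FP (circuit_tree k)"
  unfolding circuit_tree_def
  by (intro FP_concat_map FP_Dot FP_find_pos FP_enc_list FP_gate_tree FP_hd FP_tl FP_const FP_id
      FP_key_list FP_node_table FP_tuples)

section \<open>Agreement of the tree construction with the circuit\<close>

context
  fixes k n :: nat and L :: light_form
  assumes k: "k \<ge> 2" and dag: "dag_protocol k n L"
begin

lemma node_table_enc:
  "node_table (enc_light k L) =
     enc_list (map (\<lambda>i. Dot (enc_nat i) (enc_node k L i)) (rev [0..<num_nodes L]))"
proof -
  let ?xs = "map (enc_node k L) [0..<num_nodes L]"
  have "node_table (enc_light k L) = table (enc_list (rev ?xs))"
    by (simp add: node_table_def enc_light_def trev_enc_list)
  also have "\<dots> = enc_list (map (\<lambda>i. Dot (enc_nat i) (?xs ! i)) (rev [0..<num_nodes L]))"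
    by (simp only: table_enc_list) simp
  also have "map (\<lambda>i. Dot (enc_nat i) (?xs ! i)) (rev [0..<num_nodes L])
     = map (\<lambda>i. Dot (enc_nat i) (enc_node k L i)) (rev [0..<num_nodes L])" by auto
  finally show ?thesis .
qed

lemma look_node_table:
  "v < num_nodes L \<Longrightarrow> look (enc_nat v) (node_table (enc_light k L)) = enc_node k L v"
  unfolding node_table_enc by (rule look_enc_list) simp

lemma node_names_enc: "node_names (enc_light k L) = enc_list (map enc_nat (rev [0..<num_nodes L]))"
proof -
  have "node_names (enc_light k L) = enc_list (concat (map (\<lambda>i. [enc_nat i]) (rev [0..<num_nodes L])))"
    unfolding node_names_def node_table_enc by (rule concat_map_enc_list) simp
  then show ?thesis by (simp only: concat_map_singleton)
qed

lemma tuples_enc: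
  "tuples m (enc_light k L) = enc_list (map enc_state (List.n_lists m (rev [0..<num_nodes L])))"
proof (induction m)
  case 0
  then show ?case by (simp add: enc_state_def)
next
  case (Suc m)
  let ?ns = "rev [0..<num_nodes L]"
  have "concat_map (\<lambda>q. Dot (Dot (tl_tree q) (hd_tree q)) Atom) (enc_state ys) (enc_list (map enc_nat ?ns))
     = enc_list (concat (map (\<lambda>y. [enc_state (y # ys)]) ?ns))" for ys
    by (rule concat_map_enc_list) (simp add: enc_state_def)
  then have "tuples (Suc m) (enc_light k L) =
      enc_list (concat (map (\<lambda>ys. concat (map (\<lambda>y. [enc_state (y # ys)]) ?ns)) (List.n_lists m ?ns)))"
    unfolding tuples.simps Suc node_names_enc by (intro concat_map_enc_list) simp
  then show ?case by (simp add: map_concat comp_def)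
qed

lemma key_list_enc: "key_list k (enc_light k L) = enc_list (map enc_key (keys k L))"
proof -
  have "key_list k (enc_light k L) =
      enc_list (concat (map (\<lambda>U. map (\<lambda>S. enc_key (U, S)) (stages k)) (states k L)))"
    unfolding key_list_def tuples_enc states_def
    by (rule concat_map_enc_list) (simp add: enc_key_def)
  then show ?thesis by (simp add: keys_def product_concat_map map_concat comp_def)
qed

lemma find_key: "find_pos (enc_key K) (key_list k (enc_light k L)) = enc_nat (position K (keys k L))"
  unfolding key_list_enc by (rule find_pos_enc_list) (rule enc_key_eq_iff)

lemma funpow_tl_enc_list: "m < length xs \<Longrightarrow> hd_tree ((tl_tree ^^ m) (enc_list xs)) = xs ! m"
proof (induction m arbitrary: xs)
  case 0
  then show ?case by (cases xs) auto
next
  case (Suc m)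
  then show ?case by (cases xs) (auto simp del: funpow.simps simp: funpow_Suc_right)
qed

lemma token_tree_enc:
  assumes "length U = length (roles k)" "\<phi> \<in> set (roles k)"
  shows "token_tree k (enc_state U) \<phi> = enc_nat (token k U \<phi>)"
  using assms by (simp add: token_tree_def token_def enc_state_def funpow_tl_enc_list position)

lemma reply_enc:
  assumes "v \<in> inner L" "owner k L v \<in> set is"
  shows "reply (enc_node k L v) \<beta> is = enc_nat (child L v (\<beta> (owner k L v)))"
  using assms(2) by (induction "is") (auto simp: enc_node_def assms(1) enc_nat_eq_iff)

lemma enc_node_hd: "hd_tree (enc_node k L v) = Atom \<longleftrightarrow> v \<notin> inner L"
  by (simp add: enc_node_def)

lemma advance_tree_enc:
  assumes "(U, S) \<in> set (keys k L)"
  shows "advance_tree k (node_table (enc_light k L)) (enc_state U) S = enc_state (advance k L U S)"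
proof -
  have U: "length U = length (roles k)" "set U \<subseteq> {..<num_nodes L}" and S: "S \<in> set (stages k)"
    using assms by (auto simp: set_keys)
  let ?tab = "node_table (enc_light k L)"
  show ?thesis
    unfolding advance_tree_def advance_def enc_state_def[of "map _ _"] map_map comp_def
  proof (rule arg_cong[where f = enc_list], rule map_cong[OF refl])
    fix \<phi> assume "\<phi> \<in> set (roles k)"
    let ?\<psi> = "map (\<lambda>j. fst (S ! j)) \<phi>"
    have \<psi>: "?\<psi> \<in> set (roles k)" by (rule comp_roles[OF S]) fact
    have "token k U ?\<psi> \<in> set U" by (rule token_in[OF U(1) \<psi>])
    \<comment> \<open>The tokens of a key are nodes of the protocol, so the lookup meets an
      entry.\<close>
    then have look: "look (enc_nat (token k U ?\<psi>)) ?tab = enc_node k L (token k U ?\<psi>)"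
      using U(2) by (intro look_node_table) auto
    have "owner k L (token k U ?\<psi>) \<in> set [0..<k]" if "token k U ?\<psi> \<in> inner L"
      using owner_less[OF k dag that, of 0] k by simp
    then show "(if hd_tree (look (token_tree k (enc_state U) ?\<psi>) ?tab) = Atom
        then token_tree k (enc_state U) ?\<psi>
        else reply (look (token_tree k (enc_state U) ?\<psi>) ?tab)
          (\<lambda>i. snd (S ! (\<phi> ! i)) ! position ?\<psi> (roles k)) [0..<k]) =
      enc_nat (let \<psi> = ?\<psi>; u = token k U \<psi>
        in if u \<in> inner L then child L u (snd (S ! (\<phi> ! owner k L u)) ! position \<psi> (roles k)) else u)"
      by (simp add: token_tree_enc[OF U(1) \<psi>] look enc_node_hd reply_enc Let_def)
  qed
qed

lemma succ_trees_enc: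
  assumes "(U, S) \<in> set (keys k L)"
  shows "succ_trees k (node_table (enc_light k L)) (enc_state U) S = map enc_key (succs k L U S)"
  by (simp add: succ_trees_def succs_def enc_key_def advance_tree_enc[OF assms])

lemma gate_tree_enc:
  assumes "(U, S) \<in> set (keys k L)"
  shows "gate_tree k (node_table (enc_light k L)) (key_list k (enc_light k L)) (enc_state U) S
     = enc_gate (key_gate k L U S)"
proof -
  have U: "length U = length (roles k)" "set U \<subseteq> {..<num_nodes L}"
    using assms by (auto simp: set_keys)
  let ?u = "token k U [0..<k]"
  have "?u \<in> set U" by (rule token_in[OF U(1) id_role[OF k dag]])
  then have look: "look (enc_nat ?u) (node_table (enc_light k L)) = enc_node k L ?u"
    using U(2) by (intro look_node_table) auto
  have "enc_bool (enc_bool b = Atom) = enc_bool (\<not> b)" for b by (cases b) auto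
  then show ?thesis
    by (simp add: gate_tree_def token_tree_enc[OF U(1) id_role[OF k dag]] look enc_node_hd
        succ_trees_enc[OF assms] key_gate_def find_key comp_def)
      (simp add: enc_node_def Let_def)
qed

lemma circuit_tree_enc: "circuit_tree k (enc_light k L) = enc_circuit (protocol_circuit k L)"
proof -
  let ?d = "enc_light k L"
  have "map (\<lambda>\<phi>. hd_tree ?d) (roles k) = map enc_nat (replicate (length (roles k)) (start L))"
    by (simp add: map_replicate_const enc_light_def)
  then have out: "Dot (enc_list (map (\<lambda>\<phi>. hd_tree ?d) (roles k))) (enc_list (map enc_piece (pieces k)))
     = enc_key (replicate (length (roles k)) (start L), pieces k)"
    by (simp only: enc_key_def enc_state_def fst_conv snd_conv)
  have "concat_map (\<lambda>p. enc_list (map (gate_tree k (hd_tree (hd_tree p)) (tl_tree (hd_tree p)) (tl_tree p)) (stages k)))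
        (Dot (node_table ?d) (key_list k ?d)) (tuples (length (roles k)) ?d)
     = enc_list (concat (map (\<lambda>U. map (\<lambda>S. enc_gate (key_gate k L U S)) (stages k)) (states k L)))"
    unfolding tuples_enc states_def[symmetric]
  proof (rule concat_map_enc_list)
    fix U assume "U \<in> set (states k L)"
    then have "(U, S) \<in> set (keys k L)" if "S \<in> set (stages k)" for S
      using that by (simp add: keys_def)
    then show "enc_list (map (gate_tree k (hd_tree (hd_tree (Dot (Dot (node_table ?d) (key_list k ?d)) (enc_state U))))
        (tl_tree (hd_tree (Dot (Dot (node_table ?d) (key_list k ?d)) (enc_state U))))
        (tl_tree (Dot (Dot (node_table ?d) (key_list k ?d)) (enc_state U)))) (stages k))
      = enc_list (map (\<lambda>S. enc_gate (key_gate k L U S)) (stages k))"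
      by (simp add: gate_tree_enc cong: map_cong)
  qed
  also have "concat (map (\<lambda>U. map (\<lambda>S. enc_gate (key_gate k L U S)) (stages k)) (states k L))
     = map enc_gate (gates (protocol_circuit k L))"
    by (simp add: protocol_circuit_def keys_def product_concat_map map_concat comp_def)
  finally show ?thesis
    unfolding circuit_tree_def out find_key enc_circuit_def by (simp add: protocol_circuit_def)
qed

end

theorem theorem7:
  fixes k :: nat
  assumes "k \<ge> 2"
  shows "\<exists>A. poly_time A \<and>
           (\<exists>a b c. \<forall>n f \<pi>.
              f \<in> R k n \<longrightarrow> dag_protocol k n \<pi> \<longrightarrow> strongly_computes k n f \<pi> \<longrightarrow>
              (\<exists>C. outputs A (enc_light k (light \<pi>)) (enc_circuit C) \<and>
                   thr_circuit k n C \<and>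
                   circuit_le n C f \<and>
                   circuit_depth C \<le> a * protocol_depth \<pi> \<and>
                   circuit_size C \<le> b * protocol_size \<pi> ^ c))"
proof -
  obtain A where A: "poly_time A" "\<And>d. outputs A d (circuit_tree k d)"
    using FP_poly_time[OF FP_circuit_tree] by blast
  \<comment> \<open>The three constants are twice the number of pieces plus one, the number of
    stages and the number of role assignments, all determined by \<open>k\<close>.\<close>
  have "outputs A (enc_light k (light \<pi>)) (enc_circuit (protocol_circuit k (light \<pi>))) \<and>
        thr_circuit k n (protocol_circuit k (light \<pi>)) \<and>
        circuit_le n (protocol_circuit k (light \<pi>)) f \<and>
        circuit_depth (protocol_circuit k (light \<pi>)) \<le> (2 * length (pieces k) + 1) * protocol_depth \<pi> \<and>
        circuit_size (protocol_circuit k (light \<pi>)) \<le> length (stages k) * protocol_size \<pi> ^ length (roles k)"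
    if "dag_protocol k n \<pi>" and strong: "strongly_computes k n f \<pi>" for n f \<pi>
  proof -
    have dag: "dag_protocol k n (light \<pi>)" using that(1) by (simp only: dag_light)
    show ?thesis
      using A(2)[of "enc_light k (light \<pi>)"] circuit_tree_enc[OF assms dag]
        thr_protocol_circuit[OF assms dag] circuit_le_protocol_circuit[OF assms dag strong]
        depth_protocol_circuit[OF assms dag] height_start[of \<pi>]
        size_protocol_circuit[OF assms dag]
      by (simp add: protocol_size_def)
  qed
  then show ?thesis using A(1) by blast
qed

end
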